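(* Let $X$ be a locally compact space, let $\sigma\colon U\to V$ be a partial homeomorphism of $X$ (a homeomorphism from an open subset $U\subset X$ onto an open subset $V\subset X$), and let $\theta\colon C_0(U)\to C_0(V)$ be $\theta(f)=f\circ\sigma^{-1}$. Let $E=(E^0,E^1,d,r)$ be the topological graph with $E^0=X$, $E^1=U$, $r=\sigma$, and $d\colon U\to X$ the inclusion. Then there exists a natural isomorphism $\mathcal{O}(E)\cong C_0(X)\rtimes_\theta\mathbb{Z}$.
   Context: $C_0(X)\rtimes_\theta\mathbb{Z}$ is the crossed product by the partial automorphism $(\theta,C_0(V),C_0(U))$. It is characterized as the universal $C^*$-algebra generated by the images of a $*$-homomorphism $\rho^0\colon C_0(X)\to C_0(X)\rtimes_\theta\mathbb{Z}$ and a linear map $\rho^1\colon C_0(V)\to C_0(X)\rtimes_\theta\mathbb{Z}$ satisfying, for $f\in C_0(X)$ and $g,h\in C_0(V)$: (i) $\rho^0(f)\rho^1(g)=\rho^1(fg)$; (ii) $\rho^1(g)\rho^0(f)=\rho^1(\theta(\theta^{-1}(g)f))$; (iii) $\rho^1(g)\rho^1(h)^*=\rho^0(g\overline h)$; (iv) $\rho^1(g)^*\rho^1(h)=\rho^0(\theta^{-1}(\overline g h))$. A topological graph $E=(E^0,E^1,d,r)$ consists of two locally compact (Hausdorff) spaces $E^0,E^1$, a local homeomorphism $d\colon E^1\to E^0$ and a continuous map $r\colon E^1\to E^0$. $C_d(E^1)$ is the set of continuous functions $\xi$ on $E^1$ such that $\langle\xi,\xi\rangle(v)=\sum_{e\in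 d^{-1}(v)}|\xi(e)|^2<\infty$ for all $v\in E^0$ and $\langle\xi,\xi\rangle\in C_0(E^0)$. It is a right Hilbert $C_0(E^0)$-module with $(\xi f)(e)=\xi(e)f(d(e))$ and $\langle\xi,\eta\rangle(v)=\sum_{e\in d^{-1}(v)}\overline{\xi(e)}\eta(e)$. The left action $\pi_r$ of $C_0(E^0)$ is $(\pi_r(f)\xi)(e)=f(r(e))\xi(e)$. $\mathcal{K}(C_d(E^1))$ denotes the compact operators, the closed span of the rank-one operators $\theta_{\xi,\eta}\colon\zeta\mapsto\xi\langle\eta,\zeta\rangle$. For the graph in the claim, $C_d(E^1)=C_0(U)$. A Toeplitz $E$-pair in a $C^*$-algebra $A$ is a pair $T=(T^0,T^1)$ of a $*$-homomorphism $T^0\colon C_0(E^0)\to A$ and a linear map $T^1\colon C_d(E^1)\to A$ with $T^1(\xi)^*T^1(\eta)=T^0(\langle\xi,\eta\rangle)$ and $T^0(f)T^1(\xi)=T^1(\pi_r(f)\xi)$. It determines a $*$-homomorphism $\varPhi\colon\mathcal{K}(C_d(E^1))\to A$ with $\varPhi(\theta_{\xi,\eta})=T^1(\xi)T^1(\eta)^*$. $E^0_{\mathrm{sce}}=E^0\setminus\overline{r(E^1)}$; $E^0_{\mathrm{fin}}$ is the set of $v\in E^0$ having a neighborhood $W$ with $r^{-1}(W)$ compact; $E^0_{\mathrm{rg}}=E^0_{\mathrm{fin}}\setminus\overline{E^0_{\mathrm{sce}}}$ (open in $E^0$). For $f\in C_0(E^0_{\mathrm{rg}})\subset C_0(E^0)$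 one has $\pi_r(f)\in\mathcal{K}(C_d(E^1))$. $T$ is a Cuntz-Krieger $E$-pair if $T^0(f)=\varPhi(\pi_r(f))$ for all $f\in C_0(E^0_{\mathrm{rg}})$. $\mathcal{O}(E)$ is the universal $C^*$-algebra generated by a Cuntz-Krieger $E$-pair $t=(t^0,t^1)$. "Natural" means that the isomorphism carries $t^0$ to $\rho^0$ and $t^1$ to $\rho^1\circ\theta$. *)

theory Defs
  imports "HOL-Analysis.Analysis"
begin

section \<open>C*-algebras\<close>

record 'a cstar =
  carr :: "'a set"
  cs_zero :: 'a  ("\<zero>\<index>")
  cs_add :: "'a \<Rightarrow> 'a \<Rightarrow> 'a"  (infixl "\<oplus>\<index>" 65)
  cs_scale :: "complex \<Rightarrow> 'a \<Rightarrow> 'a"  (infixr "\<odot>\<index>" 75)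
  cs_mult :: "'a \<Rightarrow> 'a \<Rightarrow> 'a"  (infixl "\<otimes>\<index>" 70)
  cs_star :: "'a \<Rightarrow> 'a"  ("_\<^sup>\<star>\<index>" [1000] 999)
  cs_norm :: "'a \<Rightarrow> real"  ("\<parallel>_\<parallel>\<index>")

definition cs_dist :: "('a, 'm) cstar_scheme \<Rightarrow> 'a \<Rightarrow> 'a \<Rightarrow> real"
  where "cs_dist A x y = cs_norm A (cs_add A x (cs_scale A (-1) y))"

text \<open>Complex C*-algebras, not necessarily unital; the zero algebra is allowed.\<close>

locale cstar_algebra =
  fixes A :: "('a, 'm) cstar_scheme" (structure)
  assumes zero_closed: "\<zero> \<in> carr A"
    and add_closed: "\<lbrakk>x \<in> carr A; y \<in> carr A\<rbrakk> \<Longrightarrow> x \<oplus> y \<in> carr A"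
    and scale_closed: "x \<in> carr A \<Longrightarrow> c \<odot> x \<in> carr A"
    and mult_closed: "\<lbrakk>x \<in> carr A; y \<in> carr A\<rbrakk> \<Longrightarrow> x \<otimes> y \<in> carr A"
    and star_closed: "x \<in> carr A \<Longrightarrow> x\<^sup>\<star> \<in> carr A"
    and add_assoc: "\<lbrakk>x \<in> carr A; y \<in> carr A; z \<in> carr A\<rbrakk> \<Longrightarrow> (x \<oplus> y) \<oplus> z = x \<oplus> (y \<oplus> z)"
    and add_commute: "\<lbrakk>x \<in> carr A; y \<in> carr A\<rbrakk> \<Longrightarrow> x \<oplus> y = y \<oplus> x"
    and add_zero: "x \<in> carr A \<Longrightarrow> x \<oplus> \<zero> = x"
    and add_inverse: "x \<in> carr A \<Longrightarrow> x \<oplus> (-1) \<odot> x = \<zero>"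
    and scale_one: "x \<in> carr A \<Longrightarrow> 1 \<odot> x = x"
    and scale_scale: "x \<in> carr A \<Longrightarrow> a \<odot> (b \<odot> x) = (a * b) \<odot> x"
    and scale_add_right: "\<lbrakk>x \<in> carr A; y \<in> carr A\<rbrakk> \<Longrightarrow> a \<odot> (x \<oplus> y) = a \<odot> x \<oplus> a \<odot> y"
    and scale_add_left: "x \<in> carr A \<Longrightarrow> (a + b) \<odot> x = a \<odot> x \<oplus> b \<odot> x"
    and mult_assoc: "\<lbrakk>x \<in> carr A; y \<in> carr A; z \<in> carr A\<rbrakk> \<Longrightarrow> (x \<otimes> y) \<otimes> z = x \<otimes> (y \<otimes> z)"
    and mult_add_left:
      "\<lbrakk>x \<in> carr A; y \<in> carr A; z \<in> carr A\<rbrakk> \<Longrightarrow> (x \<oplus> y) \<otimes> z = x \<otimes> z \<oplus> y \<otimes> z"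
    and mult_add_right:
      "\<lbrakk>x \<in> carr A; y \<in> carr A; z \<in> carr A\<rbrakk> \<Longrightarrow> x \<otimes> (y \<oplus> z) = x \<otimes> y \<oplus> x \<otimes> z"
    and mult_scale_left: "\<lbrakk>x \<in> carr A; y \<in> carr A\<rbrakk> \<Longrightarrow> (c \<odot> x) \<otimes> y = c \<odot> (x \<otimes> y)"
    and mult_scale_right: "\<lbrakk>x \<in> carr A; y \<in> carr A\<rbrakk> \<Longrightarrow> x \<otimes> (c \<odot> y) = c \<odot> (x \<otimes> y)"
    and star_star: "x \<in> carr A \<Longrightarrow> (x\<^sup>\<star>)\<^sup>\<star> = x"
    and star_add: "\<lbrakk>x \<in> carr A; y \<in> carr A\<rbrakk> \<Longrightarrow> (x \<oplus> y)\<^sup>\<star> = x\<^sup>\<star> \<oplus> y\<^sup>\<star>"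
    and star_scale: "x \<in> carr A \<Longrightarrow> (c \<odot> x)\<^sup>\<star> = cnj c \<odot> x\<^sup>\<star>"
    and star_mult: "\<lbrakk>x \<in> carr A; y \<in> carr A\<rbrakk> \<Longrightarrow> (x \<otimes> y)\<^sup>\<star> = y\<^sup>\<star> \<otimes> x\<^sup>\<star>"
    and norm_nonneg: "x \<in> carr A \<Longrightarrow> 0 \<le> \<parallel>x\<parallel>"
    and norm_eq_0: "x \<in> carr A \<Longrightarrow> \<parallel>x\<parallel> = 0 \<longleftrightarrow> x = \<zero>"
    and norm_triangle: "\<lbrakk>x \<in> carr A; y \<in> carr A\<rbrakk> \<Longrightarrow> \<parallel>x \<oplus> y\<parallel> \<le> \<parallel>x\<parallel> + \<parallel>y\<parallel>"
    and norm_scale: "x \<in> carr A \<Longrightarrow> \<parallel>c \<odot> x\<parallel> = cmod c * \<parallel>x\<parallel>"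
    and norm_mult: "\<lbrakk>x \<in> carr A; y \<in> carr A\<rbrakk> \<Longrightarrow> \<parallel>x \<otimes> y\<parallel> \<le> \<parallel>x\<parallel> * \<parallel>y\<parallel>"
    and norm_star_mult: "x \<in> carr A \<Longrightarrow> \<parallel>x\<^sup>\<star> \<otimes> x\<parallel> = \<parallel>x\<parallel>\<^sup>2"
    and complete: "Metric_space.mcomplete (carr A) (cs_dist A)"

definition star_hom :: "('a, 'm) cstar_scheme \<Rightarrow> ('b, 'n) cstar_scheme \<Rightarrow> ('a \<Rightarrow> 'b) \<Rightarrow> bool"
  where "star_hom A B \<phi> \<longleftrightarrow>
    (\<forall>x\<in>carr A. \<phi> x \<in> carr B) \<and>
    (\<forall>x\<in>carr A. \<forall>y\<in>carr A. \<phi> (x \<oplus>\<^bsub>A\<^esub> y) = \<phi> x \<oplus>\<^bsub>B\<^esub> \<phi> y) \<and>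
    (\<forall>c. \<forall>x\<in>carr A. \<phi> (c \<odot>\<^bsub>A\<^esub> x) = c \<odot>\<^bsub>B\<^esub> \<phi> x) \<and>
    (\<forall>x\<in>carr A. \<forall>y\<in>carr A. \<phi> (x \<otimes>\<^bsub>A\<^esub> y) = \<phi> x \<otimes>\<^bsub>B\<^esub> \<phi> y) \<and>
    (\<forall>x\<in>carr A. \<phi> (x\<^sup>\<star>\<^bsub>A\<^esub>) = (\<phi> x)\<^sup>\<star>\<^bsub>B\<^esub>)"

definition star_iso :: "('a, 'm) cstar_scheme \<Rightarrow> ('b, 'n) cstar_scheme \<Rightarrow> ('a \<Rightarrow> 'b) \<Rightarrow> bool"
  where "star_iso A B \<phi> \<longleftrightarrow> star_hom A B \<phi> \<and> bij_betw \<phi> (carr A) (carr B)"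

definition cstar_subalgebra :: "('a, 'm) cstar_scheme \<Rightarrow> 'a set \<Rightarrow> bool"
  where "cstar_subalgebra A S \<longleftrightarrow>
    S \<subseteq> carr A \<and> \<zero>\<^bsub>A\<^esub> \<in> S \<and>
    (\<forall>x\<in>S. \<forall>y\<in>S. x \<oplus>\<^bsub>A\<^esub> y \<in> S) \<and> (\<forall>c. \<forall>x\<in>S. c \<odot>\<^bsub>A\<^esub> x \<in> S) \<and>
    (\<forall>x\<in>S. \<forall>y\<in>S. x \<otimes>\<^bsub>A\<^esub> y \<in> S) \<and> (\<forall>x\<in>S. x\<^sup>\<star>\<^bsub>A\<^esub> \<in> S) \<and>
    closedin (Metric_space.mtopology (carr A) (cs_dist A)) S"

definition generates :: "('a, 'm) cstar_scheme \<Rightarrow> 'a set \<Rightarrow> bool"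
  where "generates A G \<longleftrightarrow> G \<subseteq> carr A \<and> (\<forall>S. cstar_subalgebra A S \<and> G \<subseteq> S \<longrightarrow> S = carr A)"

text \<open>Linearity of a map from a set \<open>S\<close> of complex functions (with pointwise operations).\<close>

definition linear_into :: "('x \<Rightarrow> complex) set \<Rightarrow> ('a, 'm) cstar_scheme \<Rightarrow> (('x \<Rightarrow> complex) \<Rightarrow> 'a) \<Rightarrow> bool"
  where "linear_into S A T \<longleftrightarrow>
    (\<forall>f\<in>S. T f \<in> carr A) \<and>
    (\<forall>f\<in>S. \<forall>g\<in>S. T (\<lambda>x. f x + g x) = T f \<oplus>\<^bsub>A\<^esub> T g) \<and>
    (\<forall>c. \<forall>f\<in>S. T (\<lambda>x. c * f x) = c \<odot>\<^bsub>A\<^esub> T f)"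

section \<open>Functions vanishing at infinity\<close>

text \<open>Elements of \<open>C\<^sub>0(X)\<close> are represented as functions on the whole type that are zero outside
  \<open>topspace X\<close>. For an open set \<open>W\<close> of a Hausdorff space \<open>X\<close>, the set \<open>C0 (subtopology X W)\<close> is
  thereby a subset of \<open>C0 X\<close>: the usual embedding by extension by zero is the identity.\<close>

definition C0 :: "'x topology \<Rightarrow> ('x \<Rightarrow> complex) set"
  where "C0 X = {f. continuous_map X euclidean f \<and>
    (\<forall>\<epsilon>>0. compactin X {x \<in> topspace X. \<epsilon> \<le> cmod (f x)}) \<and>
    (\<forall>x. x \<notin> topspace X \<longrightarrow> f x = 0)}"

text \<open>The supremum is over the whole type (rather than over \<open>topspace X\<close>), which makes no
  difference for elements of \<open>C0 X\<close> and is meaningful also when \<open>X\<close> is empty.\<close>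

definition sup_norm :: "('x \<Rightarrow> complex) \<Rightarrow> real"
  where "sup_norm f = (SUP x. cmod (f x))"

definition C0_alg :: "'x topology \<Rightarrow> ('x \<Rightarrow> complex) cstar"
  where "C0_alg X =
    \<lparr>carr = C0 X,
     cs_zero = (\<lambda>x. 0),
     cs_add = (\<lambda>f g x. f x + g x),
     cs_scale = (\<lambda>c f x. c * f x),
     cs_mult = (\<lambda>f g x. f x * g x),
     cs_star = (\<lambda>f x. cnj (f x)),
     cs_norm = sup_norm\<rparr>"

section \<open>Topological graphs and their Hilbert modules\<close>

record ('v, 'e) top_graph =
  E0 :: "'v topology"
  E1 :: "'e topology"
  dom_map :: "'e \<Rightarrow> 'v"
  ran_map :: "'e \<Rightarrow> 'v"

definition local_homeomorphism :: "'a topology \<Rightarrow> 'b topology \<Rightarrow> ('a \<Rightarrow> 'b) \<Rightarrow> bool"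
  where "local_homeomorphism X Y f \<longleftrightarrow>
    (\<forall>x\<in>topspace X. \<exists>W. openin X W \<and> x \<in> W \<and> openin Y (f ` W) \<and>
       homeomorphic_map (subtopology X W) (subtopology Y (f ` W)) f)"

definition topological_graph :: "('v, 'e) top_graph \<Rightarrow> bool"
  where "topological_graph E \<longleftrightarrow>
    locally_compact_space (E0 E) \<and> Hausdorff_space (E0 E) \<and>
    locally_compact_space (E1 E) \<and> Hausdorff_space (E1 E) \<and>
    local_homeomorphism (E1 E) (E0 E) (dom_map E) \<and>
    continuous_map (E1 E) (E0 E) (ran_map E)"

definition fibre :: "('v, 'e) top_graph \<Rightarrow> 'v \<Rightarrow> 'e set"
  where "fibre E v = {e \<in> topspace (E1 E). dom_map E e = v}"

definition inner_d :: "('v, 'e) top_graph \<Rightarrow> ('e \<Rightarrow> complex) \<Rightarrow> ('e \<Rightarrow> complex) \<Rightarrow> 'v \<Rightarrow> complex"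
  where "inner_d E \<xi> \<eta> v = (\<Sum>\<^sub>\<infinity>e\<in>fibre E v. cnj (\<xi> e) * \<eta> e)"

text \<open>As for \<open>C0\<close>, functions on the edge space are zero outside its carrier.\<close>

definition Cd :: "('v, 'e) top_graph \<Rightarrow> ('e \<Rightarrow> complex) set"
  where "Cd E = {\<xi>. continuous_map (E1 E) euclidean \<xi> \<and>
    (\<forall>e. e \<notin> topspace (E1 E) \<longrightarrow> \<xi> e = 0) \<and>
    (\<forall>v\<in>topspace (E0 E). (\<lambda>e. (cmod (\<xi> e))\<^sup>2) summable_on fibre E v) \<and>
    inner_d E \<xi> \<xi> \<in> C0 (E0 E)}"

definition norm_d :: "('v, 'e) top_graph \<Rightarrow> ('e \<Rightarrow> complex) \<Rightarrow> real"
  where "norm_d E \<xi> = sqrt (sup_norm (inner_d E \<xi> \<xi>))"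

definition act_right :: "('v, 'e) top_graph \<Rightarrow> ('e \<Rightarrow> complex) \<Rightarrow> ('v \<Rightarrow> complex) \<Rightarrow> 'e \<Rightarrow> complex"
  where "act_right E \<xi> f = (\<lambda>e. \<xi> e * f (dom_map E e))"

text \<open>Operators on \<open>Cd E\<close> are functions restricted to \<open>Cd E\<close> (i.e. \<open>undefined\<close> elsewhere), so that
  equality of operators is equality of functions.\<close>

definition pi_r :: "('v, 'e) top_graph \<Rightarrow> ('v \<Rightarrow> complex) \<Rightarrow> ('e \<Rightarrow> complex) \<Rightarrow> 'e \<Rightarrow> complex"
  where "pi_r E f = (\<lambda>\<xi>\<in>Cd E. \<lambda>e. f (ran_map E e) * \<xi> e)"

definition rank_one ::
    "('v, 'e) top_graph \<Rightarrow> ('e \<Rightarrow> complex) \<Rightarrow> ('e \<Rightarrow> complex) \<Rightarrow> ('e \<Rightarrow> complex) \<Rightarrow> 'e \<Rightarrow> complex"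
  where "rank_one E \<xi> \<eta> = (\<lambda>\<zeta>\<in>Cd E. act_right E \<xi> (inner_d E \<eta> \<zeta>))"

definition is_adjoint ::
    "('v, 'e) top_graph \<Rightarrow> (('e \<Rightarrow> complex) \<Rightarrow> 'e \<Rightarrow> complex) \<Rightarrow> (('e \<Rightarrow> complex) \<Rightarrow> 'e \<Rightarrow> complex) \<Rightarrow> bool"
  where "is_adjoint E T S \<longleftrightarrow>
    T \<in> Cd E \<rightarrow>\<^sub>E Cd E \<and> S \<in> Cd E \<rightarrow>\<^sub>E Cd E \<and>
    (\<forall>\<xi>\<in>Cd E. \<forall>\<eta>\<in>Cd E. inner_d E (T \<xi>) \<eta> = inner_d E \<xi> (S \<eta>))"

definition adjointable :: "('v, 'e) top_graph \<Rightarrow> (('e \<Rightarrow> complex) \<Rightarrow> 'e \<Rightarrow> complex) set"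
  where "adjointable E = {T. \<exists>S. is_adjoint E T S}"

definition finite_rank :: "('v, 'e) top_graph \<Rightarrow> (('e \<Rightarrow> complex) \<Rightarrow> 'e \<Rightarrow> complex) set"
  where "finite_rank E =
    {(\<lambda>\<zeta>\<in>Cd E. \<lambda>e. \<Sum>i<n. c i * rank_one E (\<xi> i) (\<eta> i) \<zeta> e) | (n::nat) c \<xi> \<eta>.
       \<forall>i<n. \<xi> i \<in> Cd E \<and> \<eta> i \<in> Cd E}"

text \<open>The closure is taken for the operator norm: the last clause says that the distance from
  \<open>T\<close> to \<open>S\<close> is at most \<open>\<epsilon>\<close>.\<close>

definition compact_ops :: "('v, 'e) top_graph \<Rightarrow> (('e \<Rightarrow> complex) \<Rightarrow> 'e \<Rightarrow> complex) set"
  where "compact_ops E = {T \<in> adjointable E. \<forall>\<epsilon>>0. \<exists>S\<in>finite_rank E. \<forall>\<zeta>\<in>Cd E.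
    norm_d E (\<lambda>e. T \<zeta> e - S \<zeta> e) \<le> \<epsilon> * norm_d E \<zeta>}"

definition compact_alg :: "('v, 'e) top_graph \<Rightarrow> (('e \<Rightarrow> complex) \<Rightarrow> 'e \<Rightarrow> complex) cstar"
  where "compact_alg E =
    \<lparr>carr = compact_ops E,
     cs_zero = (\<lambda>\<zeta>\<in>Cd E. \<lambda>e. 0),
     cs_add = (\<lambda>S T. \<lambda>\<zeta>\<in>Cd E. \<lambda>e. S \<zeta> e + T \<zeta> e),
     cs_scale = (\<lambda>c T. \<lambda>\<zeta>\<in>Cd E. \<lambda>e. c * T \<zeta> e),
     cs_mult = (\<lambda>S T. compose (Cd E) S T),
     cs_star = (\<lambda>T. THE S. is_adjoint E T S),
     cs_norm = (\<lambda>T. Inf {c. 0 \<le> c \<and> (\<forall>\<zeta>\<in>Cd E. norm_d E (T \<zeta>) \<le> c * norm_d E \<zeta>)})\<rparr>"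

section \<open>Cuntz-Krieger pairs and the algebra of a topological graph\<close>

definition E0_sce :: "('v, 'e) top_graph \<Rightarrow> 'v set"
  where "E0_sce E = topspace (E0 E) - (E0 E) closure_of (ran_map E ` topspace (E1 E))"

definition E0_fin :: "('v, 'e) top_graph \<Rightarrow> 'v set"
  where "E0_fin E = {v \<in> topspace (E0 E). \<exists>W\<subseteq>topspace (E0 E).
    (\<exists>G. openin (E0 E) G \<and> v \<in> G \<and> G \<subseteq> W) \<and>
    compactin (E1 E) {e \<in> topspace (E1 E). ran_map E e \<in> W}}"

definition E0_rg :: "('v, 'e) top_graph \<Rightarrow> 'v set"
  where "E0_rg E = E0_fin E - (E0 E) closure_of (E0_sce E)"

definition toeplitz_pair ::
    "('v, 'e) top_graph \<Rightarrow> 'a cstar \<Rightarrow> (('v \<Rightarrow> complex) \<Rightarrow> 'a) \<Rightarrow> (('e \<Rightarrow> complex) \<Rightarrow> 'a) \<Rightarrow> bool"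
  where "toeplitz_pair E A T0 T1 \<longleftrightarrow>
    star_hom (C0_alg (E0 E)) A T0 \<and> linear_into (Cd E) A T1 \<and>
    (\<forall>\<xi>\<in>Cd E. \<forall>\<eta>\<in>Cd E. (T1 \<xi>)\<^sup>\<star>\<^bsub>A\<^esub> \<otimes>\<^bsub>A\<^esub> T1 \<eta> = T0 (inner_d E \<xi> \<eta>)) \<and>
    (\<forall>f\<in>C0 (E0 E). \<forall>\<xi>\<in>Cd E. T0 f \<otimes>\<^bsub>A\<^esub> T1 \<xi> = T1 (pi_r E f \<xi>))"

text \<open>The *-homomorphism \<open>\<Phi>\<close> determined by a Toeplitz pair exists always, and it is unique on the
  compact operators because *-homomorphisms of C*-algebras are continuous.\<close>

definition cuntz_krieger_pair ::
    "('v, 'e) top_graph \<Rightarrow> 'a cstar \<Rightarrow> (('v \<Rightarrow> complex) \<Rightarrow> 'a) \<Rightarrow> (('e \<Rightarrow> complex) \<Rightarrow> 'a) \<Rightarrow> bool"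
  where "cuntz_krieger_pair E A T0 T1 \<longleftrightarrow>
    toeplitz_pair E A T0 T1 \<and>
    (\<exists>\<Phi>. star_hom (compact_alg E) A \<Phi> \<and>
       (\<forall>\<xi>\<in>Cd E. \<forall>\<eta>\<in>Cd E. \<Phi> (rank_one E \<xi> \<eta>) = T1 \<xi> \<otimes>\<^bsub>A\<^esub> (T1 \<eta>)\<^sup>\<star>\<^bsub>A\<^esub>) \<and>
       (\<forall>f\<in>C0 (subtopology (E0 E) (E0_rg E)). T0 f = \<Phi> (pi_r E f)))"

text \<open>\<open>graph_algebra E A t0 t1\<close>: the C*-algebra \<open>A\<close> together with \<open>t = (t0, t1)\<close> is (a model of) the
  universal C*-algebra generated by a Cuntz-Krieger pair. The type \<open>'a\<close> plays the role of a universe: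
  the universal property ranges over all C*-algebras whose carrier is a subset of \<open>'a\<close>.\<close>

definition graph_algebra ::
    "('v, 'e) top_graph \<Rightarrow> 'a cstar \<Rightarrow> (('v \<Rightarrow> complex) \<Rightarrow> 'a) \<Rightarrow> (('e \<Rightarrow> complex) \<Rightarrow> 'a) \<Rightarrow> bool"
  where "graph_algebra E A t0 t1 \<longleftrightarrow>
    cstar_algebra A \<and> cuntz_krieger_pair E A t0 t1 \<and>
    generates A (t0 ` C0 (E0 E) \<union> t1 ` Cd E) \<and>
    (\<forall>(B :: 'a cstar) T0 T1. cstar_algebra B \<and> cuntz_krieger_pair E B T0 T1 \<longrightarrow>
       (\<exists>!\<phi>. \<phi> \<in> extensional (carr A) \<and> star_hom A B \<phi> \<and>
          (\<forall>f\<in>C0 (E0 E). \<phi> (t0 f) = T0 f) \<and> (\<forall>\<xi>\<in>Cd E. \<phi> (t1 \<xi>) = T1 \<xi>)))"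

section \<open>Crossed products by partial automorphisms of \<open>C\<^sub>0(X)\<close>\<close>

definition covariant_pair ::
    "'x topology \<Rightarrow> 'x set \<Rightarrow> 'x set \<Rightarrow> (('x \<Rightarrow> complex) \<Rightarrow> 'x \<Rightarrow> complex) \<Rightarrow>
     'a cstar \<Rightarrow> (('x \<Rightarrow> complex) \<Rightarrow> 'a) \<Rightarrow> (('x \<Rightarrow> complex) \<Rightarrow> 'a) \<Rightarrow> bool"
  where "covariant_pair X U V \<theta> B \<rho>0 \<rho>1 \<longleftrightarrow>
    (let \<theta>' = inv_into (C0 (subtopology X U)) \<theta> in
      star_hom (C0_alg X) B \<rho>0 \<and> linear_into (C0 (subtopology X V)) B \<rho>1 \<and>
      (\<forall>f\<in>C0 X. \<forall>g\<in>C0 (subtopology X V). \<rho>0 f \<otimes>\<^bsub>B\<^esub> \<rho>1 g = \<rho>1 (\<lambda>x. f x * g x)) \<and>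
      (\<forall>f\<in>C0 X. \<forall>g\<in>C0 (subtopology X V). \<rho>1 g \<otimes>\<^bsub>B\<^esub> \<rho>0 f = \<rho>1 (\<theta> (\<lambda>x. \<theta>' g x * f x))) \<and>
      (\<forall>g\<in>C0 (subtopology X V). \<forall>h\<in>C0 (subtopology X V).
         \<rho>1 g \<otimes>\<^bsub>B\<^esub> (\<rho>1 h)\<^sup>\<star>\<^bsub>B\<^esub> = \<rho>0 (\<lambda>x. g x * cnj (h x))) \<and>
      (\<forall>g\<in>C0 (subtopology X V). \<forall>h\<in>C0 (subtopology X V).
         (\<rho>1 g)\<^sup>\<star>\<^bsub>B\<^esub> \<otimes>\<^bsub>B\<^esub> \<rho>1 h = \<rho>0 (\<theta>' (\<lambda>x. cnj (g x) * h x))))"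

text \<open>\<open>crossed_product X U V \<theta> B \<rho>0 \<rho>1\<close>: the C*-algebra \<open>B\<close> with the maps \<open>\<rho>0\<close>, \<open>\<rho>1\<close> is (a model of)
  the crossed product of \<open>C\<^sub>0(X)\<close> by the partial automorphism \<open>\<theta>\<close> from \<open>C\<^sub>0(U)\<close> onto \<open>C\<^sub>0(V)\<close>, with the
  same convention on universes as above.\<close>

definition crossed_product ::
    "'x topology \<Rightarrow> 'x set \<Rightarrow> 'x set \<Rightarrow> (('x \<Rightarrow> complex) \<Rightarrow> 'x \<Rightarrow> complex) \<Rightarrow>
     'a cstar \<Rightarrow> (('x \<Rightarrow> complex) \<Rightarrow> 'a) \<Rightarrow> (('x \<Rightarrow> complex) \<Rightarrow> 'a) \<Rightarrow> bool"
  where "crossed_product X U V \<theta> B \<rho>0 \<rho>1 \<longleftrightarrow>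
    cstar_algebra B \<and> covariant_pair X U V \<theta> B \<rho>0 \<rho>1 \<and>
    generates B (\<rho>0 ` C0 X \<union> \<rho>1 ` C0 (subtopology X V)) \<and>
    (\<forall>(D :: 'a cstar) R0 R1. cstar_algebra D \<and> covariant_pair X U V \<theta> D R0 R1 \<longrightarrow>
       (\<exists>!\<phi>. \<phi> \<in> extensional (carr B) \<and> star_hom B D \<phi> \<and>
          (\<forall>f\<in>C0 X. \<phi> (\<rho>0 f) = R0 f) \<and> (\<forall>g\<in>C0 (subtopology X V). \<phi> (\<rho>1 g) = R1 g)))"

section \<open>The graph of a partial homeomorphism\<close>

definition partial_homeomorphism :: "'x topology \<Rightarrow> 'x set \<Rightarrow> 'x set \<Rightarrow> ('x \<Rightarrow> 'x) \<Rightarrow> bool"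
  where "partial_homeomorphism X U V \<sigma> \<longleftrightarrow>
    openin X U \<and> openin X V \<and> homeomorphic_map (subtopology X U) (subtopology X V) \<sigma>"

definition push :: "'x set \<Rightarrow> 'x set \<Rightarrow> ('x \<Rightarrow> 'x) \<Rightarrow> ('x \<Rightarrow> complex) \<Rightarrow> 'x \<Rightarrow> complex"
  where "push U V \<sigma> f = (\<lambda>x. if x \<in> V then f (inv_into U \<sigma> x) else 0)"

definition partial_homeo_graph :: "'x topology \<Rightarrow> 'x set \<Rightarrow> ('x \<Rightarrow> 'x) \<Rightarrow> ('x, 'x) top_graph"
  where "partial_homeo_graph X U \<sigma> =
    \<lparr>E0 = X, E1 = subtopology X U, dom_map = (\<lambda>x. x), ran_map = \<sigma>\<rparr>"

lemma topological_graph_partial_homeo_graph: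
  assumes X: "locally_compact_space X" "Hausdorff_space X" and \<sigma>: "partial_homeomorphism X U V \<sigma>"
  shows "topological_graph (partial_homeo_graph X U \<sigma>)"
proof -
  have U: "openin X U" and hom: "homeomorphic_map (subtopology X U) (subtopology X V) \<sigma>"
    using \<sigma> by (auto simp: partial_homeomorphism_def)
  have "topspace (subtopology X U) = U"
    using openin_subset[OF U] by auto
  then have UU: "openin (subtopology X U) U"
    by (metis openin_topspace)
  have "locally_compact_space (subtopology X U)"
    using U X by (simp add: locally_compact_space_open_subset)
  moreover have "Hausdorff_space (subtopology X U)"
    using X(2) by (rule Hausdorff_space_subtopology)
  moreover have "continuous_map (subtopology X U) X \<sigma>"
    using homeomorphic_imp_continuous_map[OF hom] by (simp add: continuous_map_in_subtopology)
  moreover have "local_homeomorphism (subtopology X U) X (\<lambda>x. x)"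
    unfolding local_homeomorphism_def
  proof (intro ballI exI[of _ U] conjI)
    show "homeomorphic_map (subtopology (subtopology X U) U)
        (subtopology X ((\<lambda>x. x) ` U)) (\<lambda>x. x)"
      using homeomorphic_map_id[of "subtopology X U" "subtopology X U"]
      by (simp add: subtopology_subtopology id_def)
  qed (use U UU in auto)
  ultimately show ?thesis
    using X by (simp add: topological_graph_def partial_homeo_graph_def)
qed

lemma inner_d_partial_homeo_graph:
  assumes U: "openin X U" and \<xi>: "\<forall>e. e \<notin> U \<longrightarrow> \<xi> e = 0"
  shows "inner_d (partial_homeo_graph X U \<sigma>) \<xi> \<eta> = (\<lambda>v. cnj (\<xi> v) * \<eta> v)"
proof
  fix v
  have "fibre (partial_homeo_graph X U \<sigma>) v = (if v \<in> U then {v} else {})"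
    using openin_subset[OF U] by (auto simp: fibre_def partial_homeo_graph_def)
  then show "inner_d (partial_homeo_graph X U \<sigma>) \<xi> \<eta> v = cnj (\<xi> v) * \<eta> v"
    using \<xi> by (simp add: inner_d_def)
qed

lemma Cd_partial_homeo_graph:
  assumes X: "Hausdorff_space X" and U: "openin X U"
  shows "Cd (partial_homeo_graph X U \<sigma>) = C0 (subtopology X U)"
proof -
  let ?E = "partial_homeo_graph X U \<sigma>"
  have top: "topspace (subtopology X U) = U"
    using openin_subset[OF U] by auto
  have UX: "U \<subseteq> topspace X"
    using openin_subset[OF U] .
  have summ: "f summable_on fibre ?E v" for f :: "'a \<Rightarrow> real" and v
  proof -
    have "fibre ?E v \<subseteq> {v}"
      by (auto simp: fibre_def partial_homeo_graph_def)
    then have "finite (fibre ?E v)"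
      using finite_subset by blast
    then show ?thesis
      by simp
  qed
  have sets: "{x \<in> topspace X. \<epsilon> \<le> cmod (cnj (\<xi> x) * \<xi> x)} = {x \<in> U. sqrt \<epsilon> \<le> cmod (\<xi> x)}"
    if "\<epsilon> > 0" and "\<forall>e. e \<notin> U \<longrightarrow> \<xi> e = 0" for \<epsilon> and \<xi> :: "'a \<Rightarrow> complex"
  proof -
    have "\<epsilon> \<le> cmod (cnj (\<xi> x) * \<xi> x) \<longleftrightarrow> sqrt \<epsilon> \<le> cmod (\<xi> x)" for x
      by (simp add: norm_mult real_le_lsqrt real_le_rsqrt sqrt_le_D flip: power2_eq_square)
         (metis norm_ge_zero real_le_lsqrt sqrt_le_D)
    moreover have "x \<in> U" if "sqrt \<epsilon> \<le> cmod (\<xi> x)" for x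
      using that \<open>\<epsilon> > 0\<close> \<open>\<forall>e. e \<notin> U \<longrightarrow> \<xi> e = 0\<close>
      by (metis norm_zero not_le real_sqrt_gt_zero)
    ultimately show ?thesis
      using UX by auto
  qed
  have vanish: "(\<forall>\<epsilon>>0. compactin X {x \<in> topspace X. \<epsilon> \<le> cmod (cnj (\<xi> x) * \<xi> x)}) \<longleftrightarrow>
      (\<forall>\<epsilon>>0. compactin (subtopology X U) {x \<in> U. \<epsilon> \<le> cmod (\<xi> x)})"
    if \<xi>: "\<forall>e. e \<notin> U \<longrightarrow> \<xi> e = 0" for \<xi> :: "'a \<Rightarrow> complex"
  proof -
    have "(\<forall>\<epsilon>>0. compactin X {x \<in> topspace X. \<epsilon> \<le> cmod (cnj (\<xi> x) * \<xi> x)}) \<longleftrightarrow>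
        (\<forall>\<epsilon>>0. compactin X {x \<in> U. sqrt \<epsilon> \<le> cmod (\<xi> x)})"
      using sets[OF _ \<xi>] by simp
    also have "\<dots> \<longleftrightarrow> (\<forall>\<epsilon>>0. compactin X {x \<in> U. \<epsilon> \<le> cmod (\<xi> x)})"
    proof (intro iffI allI impI)
      fix \<epsilon> :: real
      assume *: "\<forall>\<epsilon>>0. compactin X {x \<in> U. sqrt \<epsilon> \<le> cmod (\<xi> x)}" and "\<epsilon> > 0"
      then have "compactin X {x \<in> U. sqrt (\<epsilon>\<^sup>2) \<le> cmod (\<xi> x)}"
        by (metis zero_less_power)
      with \<open>\<epsilon> > 0\<close> show "compactin X {x \<in> U. \<epsilon> \<le> cmod (\<xi> x)}"
        by simp
    qed simp
    also have "\<dots> \<longleftrightarrow> (\<forall>\<epsilon>>0. compactin (subtopology X U) {x \<in> U. \<epsilon> \<le> cmod (\<xi> x)})"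
      by (auto simp: compactin_subtopology)
    finally show ?thesis .
  qed
  have cont: "continuous_map X euclidean (\<lambda>x. cnj (\<xi> x) * \<xi> x)"
    if \<xi>: "\<xi> \<in> C0 (subtopology X U)" for \<xi> :: "'a \<Rightarrow> complex"
  proof -
    have c: "continuous_map (subtopology X U) euclidean \<xi>"
      and z: "\<forall>e. e \<notin> U \<longrightarrow> \<xi> e = 0"
      and cpt: "\<And>\<epsilon>. \<epsilon> > 0 \<Longrightarrow> compactin X {x \<in> U. \<epsilon> \<le> cmod (\<xi> x)}"
      using \<xi> unfolding C0_def top by (auto simp: compactin_subtopology)
    have opn: "openin X {x \<in> topspace X. \<xi> x \<in> W}" if W: "open W" for W
    proof (cases "0 \<in> W")
      case False
      have "openin (subtopology X U) {x \<in> U. \<xi> x \<in> W}"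
        using openin_continuous_map_preimage[OF c] W top by fastforce
      moreover have "{x \<in> topspace X. \<xi> x \<in> W} = {x \<in> U. \<xi> x \<in> W}"
        using z False UX by (metis (mono_tags, lifting) subsetD)
      ultimately show ?thesis
        using U openin_trans_full by metis
    next
      case True
      then obtain \<epsilon> where \<epsilon>: "\<epsilon> > 0" "ball 0 \<epsilon> \<subseteq> W"
        using W openE by blast
      have "openin (subtopology X U) {x \<in> U. \<xi> x \<in> W}"
        using openin_continuous_map_preimage[OF c] W top by fastforce
      then have o1: "openin X {x \<in> U. \<xi> x \<in> W}"
        using U openin_trans_full by metis
      have "closedin X {x \<in> U. \<epsilon> \<le> cmod (\<xi> x)}"
        using cpt[OF \<epsilon>(1)] X compactin_imp_closedin by metis
      then have o2: "openin X (topspace X - {x \<in> U. \<epsilon> \<le> cmod (\<xi> x)})"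
        by blast
      have "\<xi> x \<in> W" if "x \<notin> {x \<in> U. \<epsilon> \<le> cmod (\<xi> x)}" for x
      proof -
        have "cmod (\<xi> x) < \<epsilon>"
          using that z \<epsilon>(1) by (cases "x \<in> U") auto
        then show ?thesis
          using \<epsilon>(2) by auto
      qed
      then have "{x \<in> topspace X. \<xi> x \<in> W} =
          {x \<in> U. \<xi> x \<in> W} \<union> (topspace X - {x \<in> U. \<epsilon> \<le> cmod (\<xi> x)})"
        using UX by blast
      then show ?thesis
        using o1 o2 by auto
    qed
    then have "continuous_map X euclidean \<xi>"
      by (simp add: continuous_map)
    then have "continuous_map X euclidean (\<lambda>x. ((\<lambda>z. cnj z * z) \<circ> \<xi>) x)"
      unfolding comp_def[symmetric]
      by (intro continuous_map_compose[of _ euclidean])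
         (auto intro!: continuous_intros simp: o_def)
    then show ?thesis
      by (simp add: o_def)
  qed
  have E: "E0 ?E = X" "E1 ?E = subtopology X U"
    by (simp_all add: partial_homeo_graph_def)
  have Cd_iff: "\<xi> \<in> Cd ?E \<longleftrightarrow> continuous_map (subtopology X U) euclidean \<xi> \<and>
      (\<forall>e. e \<notin> U \<longrightarrow> \<xi> e = 0) \<and> inner_d ?E \<xi> \<xi> \<in> C0 X" for \<xi>
    using summ by (simp add: Cd_def E openin_subset[OF U] UX Int_absorb1)
  have C0_iff: "\<xi> \<in> C0 (subtopology X U) \<longleftrightarrow> continuous_map (subtopology X U) euclidean \<xi> \<and>
      (\<forall>\<epsilon>>0. compactin (subtopology X U) {x \<in> U. \<epsilon> \<le> cmod (\<xi> x)}) \<and>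
      (\<forall>e. e \<notin> U \<longrightarrow> \<xi> e = 0)" for \<xi>
    unfolding C0_def top by simp
  have inner_iff: "inner_d ?E \<xi> \<xi> \<in> C0 X \<longleftrightarrow>
      continuous_map X euclidean (\<lambda>x. cnj (\<xi> x) * \<xi> x) \<and>
      (\<forall>\<epsilon>>0. compactin (subtopology X U) {x \<in> U. \<epsilon> \<le> cmod (\<xi> x)})"
    if z: "\<forall>e. e \<notin> U \<longrightarrow> \<xi> e = 0" for \<xi>
  proof -
    have "\<forall>x. x \<notin> topspace X \<longrightarrow> cnj (\<xi> x) * \<xi> x = 0"
      using UX z by auto
    then show ?thesis
      unfolding inner_d_partial_homeo_graph[OF U z] vanish[OF z, symmetric]
      unfolding C0_def mem_Collect_eq by argo
  qed
  show ?thesis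
  proof (rule set_eqI)
    fix \<xi>
    show "\<xi> \<in> Cd ?E \<longleftrightarrow> \<xi> \<in> C0 (subtopology X U)"
      using Cd_iff[of \<xi>] C0_iff[of \<xi>] inner_iff[of \<xi>] cont[of \<xi>] by argo
  qed
qed

end

theory Submission
  imports Defs
begin

text \<open>
  Functions in \<open>C\<^sub>0(U)\<close> act on the Hilbert module \<open>C\<^sub>d(E\<^sup>1) = C\<^sub>0(U)\<close> by multiplication, the rank one
  operator of \<open>\<xi>\<close> and \<open>\<eta>\<close> being multiplication by \<open>\<xi> \<eta>\<^sup>*\<close>; every compact operator is of this form. The
  regular vertices are exactly the points of \<open>V\<close>, so the Cuntz-Krieger condition for \<open>(T\<^sup>0, T\<^sup>1)\<close> says that
  \<open>T\<^sup>1(\<xi>) T\<^sup>1(\<eta>)\<^sup>* = T\<^sup>0(\<theta>(\<xi> \<eta>\<^sup>*))\<close>, which is covariance relation (iii) for \<open>(T\<^sup>0, T\<^sup>1 \<circ> \<theta>\<inverse>)\<close>. Hence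
  composition with \<open>\<theta>\<close> turns covariant pairs into Cuntz-Krieger pairs and conversely, and the two
  universal properties yield mutually inverse homomorphisms.
\<close>

section \<open>Functions vanishing at infinity\<close>

lemma C0D:
  assumes "f \<in> C0 X"
  shows "continuous_map X euclidean f"
    and "\<And>\<epsilon>. \<epsilon> > 0 \<Longrightarrow> compactin X {x \<in> topspace X. \<epsilon> \<le> cmod (f x)}"
    and "\<And>x. x \<notin> topspace X \<Longrightarrow> f x = 0"
  using assms by (auto simp: C0_def)

lemma closedin_cmod_ge:
  assumes "continuous_map X euclidean f"
  shows "closedin X {x \<in> topspace X. \<epsilon> \<le> cmod (f x)}"
proof -
  have "closed {z :: complex. \<epsilon> \<le> cmod z}"
    by (intro closed_Collect_le continuous_intros)
  then show ?thesis
    using closedin_continuous_map_preimage[OF assms, of "{z. \<epsilon> \<le> cmod z}"] by simp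
qed

text \<open>Superlevel sets of a continuous function are closed, and a closed subset of a compact
  set is compact, so it suffices to enclose them in compact sets.\<close>

lemma C0I_compact:
  assumes f: "continuous_map X euclidean f" and "\<And>x. x \<notin> topspace X \<Longrightarrow> f x = 0"
    and K: "\<And>\<epsilon>. \<epsilon> > 0 \<Longrightarrow> \<exists>K. compactin X K \<and> {x \<in> topspace X. \<epsilon> \<le> cmod (f x)} \<subseteq> K"
  shows "f \<in> C0 X"
  unfolding C0_def using assms closed_compactin[OF _ _ closedin_cmod_ge[OF f]] by blast

lemma C0_dominated:
  assumes "continuous_map X euclidean f" and z: "\<And>x. x \<notin> topspace X \<Longrightarrow> f x = 0"
    and g: "g \<in> C0 X" and M: "M > 0" and le: "\<And>x. x \<in> topspace X \<Longrightarrow> cmod (f x) \<le> M * cmod (g x)"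
  shows "f \<in> C0 X"
proof (rule C0I_compact)
  fix \<epsilon> :: real assume "\<epsilon> > 0"
  then have "compactin X {x \<in> topspace X. \<epsilon> / M \<le> cmod (g x)}"
    using C0D(2)[OF g] M by simp
  moreover have "\<epsilon> / M \<le> cmod (g x)" if "x \<in> topspace X" "\<epsilon> \<le> cmod (f x)" for x
    using le[OF that(1)] that(2) M by (simp add: divide_le_eq mult.commute)
  ultimately show "\<exists>K. compactin X K \<and> {x \<in> topspace X. \<epsilon> \<le> cmod (f x)} \<subseteq> K"
    by blast
qed (use assms in auto)

text \<open>The set where the modulus is at least 1 is compact, hence so is its image. The bound
  covers the whole type because elements of \<open>C0 X\<close> vanish off the carrier.\<close>

lemma C0_bounded:
  assumes "g \<in> C0 X"
  obtains M where "M > 0" and "\<And>x. cmod (g x) \<le> M"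
proof -
  let ?K = "{x \<in> topspace X. 1 \<le> cmod (g x)}"
  have "compactin euclidean (g ` ?K)"
    using C0D(1,2)[OF assms] by (intro image_compactin) auto
  then have "bounded (g ` ?K)"
    by (simp add: compact_imp_bounded)
  then obtain B where B: "\<And>x. x \<in> ?K \<Longrightarrow> cmod (g x) \<le> B"
    by (auto simp: bounded_iff)
  have "cmod (g x) \<le> max 1 B" for x
    using B[of x] C0D(3)[OF assms, of x] by (cases "x \<in> ?K") force+
  then show ?thesis
    using that[of "max 1 B"] by simp
qed

lemma continuous_map_mult_complex:
  fixes f g :: "'x \<Rightarrow> complex"
  assumes "continuous_map X euclidean f" "continuous_map X euclidean g"
  shows "continuous_map X euclidean (\<lambda>x. f x * g x)"
  using assms by (simp add: continuous_map_atin tendsto_mult)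

lemma continuous_map_cnj:
  assumes "continuous_map X euclidean f"
  shows "continuous_map X euclidean (\<lambda>x. cnj (f x))"
  using assms by (simp add: continuous_map_atin tendsto_cnj)

lemma C0_mult:
  assumes f: "continuous_map X euclidean f" and b: "\<And>x. x \<in> topspace X \<Longrightarrow> cmod (f x) \<le> M"
    and g: "g \<in> C0 X"
  shows "(\<lambda>x. f x * g x) \<in> C0 X"
proof (rule C0_dominated[OF _ _ g, of _ "max 1 M"])
  show "continuous_map X euclidean (\<lambda>x. f x * g x)"
    using f C0D(1)[OF g] by (rule continuous_map_mult_complex)
  show "cmod (f x * g x) \<le> max 1 M * cmod (g x)" if "x \<in> topspace X" for x
    using b[OF that] by (auto simp: norm_mult intro!: mult_right_mono)
qed (use C0D(3)[OF g] in auto)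

lemma C0_mult_C0:
  assumes f: "f \<in> C0 X" and g: "g \<in> C0 X"
  shows "(\<lambda>x. f x * g x) \<in> C0 X"
  using C0_bounded[OF f] C0_mult[OF C0D(1)[OF f] _ g] by metis

lemma C0_scale: "g \<in> C0 X \<Longrightarrow> (\<lambda>x. c * g x) \<in> C0 X"
  by (rule C0_mult[of _ _ "cmod c"]) auto

lemma C0_cnj:
  assumes "g \<in> C0 X" shows "(\<lambda>x. cnj (g x)) \<in> C0 X"
  by (rule C0_dominated[OF _ _ assms zero_less_one]) (use C0D[OF assms] continuous_map_cnj in auto)

lemma C0_add:
  assumes f: "f \<in> C0 X" and g: "g \<in> C0 X"
  shows "(\<lambda>x. f x + g x) \<in> C0 X"
proof (rule C0I_compact)
  fix \<epsilon> :: real assume "\<epsilon> > 0"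
  then have "compactin X ({x \<in> topspace X. \<epsilon>/2 \<le> cmod (f x)} \<union> {x \<in> topspace X. \<epsilon>/2 \<le> cmod (g x)})"
    using C0D(2)[OF f, of "\<epsilon>/2"] C0D(2)[OF g, of "\<epsilon>/2"] by (intro compactin_Un) simp_all
  moreover have "\<epsilon>/2 \<le> cmod (f x) \<or> \<epsilon>/2 \<le> cmod (g x)" if "\<epsilon> \<le> cmod (f x + g x)" for x
    using that norm_triangle_ineq[of "f x" "g x"] by linarith
  ultimately show "\<exists>K. compactin X K \<and> {x \<in> topspace X. \<epsilon> \<le> cmod (f x + g x)} \<subseteq> K"
    by blast
qed (use C0D[OF f] C0D[OF g] continuous_map_add in auto)

lemma C0_zero: "(\<lambda>x. 0) \<in> C0 X"
  by (rule C0I_compact) (auto intro: exI[of _ "{}"])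

lemma C0_sum:
  assumes "\<And>i. i \<in> I \<Longrightarrow> f i \<in> C0 X"
  shows "(\<lambda>x. \<Sum>i\<in>I. f i x) \<in> C0 X"
  using assms by (induction I rule: infinite_finite_induct) (auto simp: C0_zero C0_add)

text \<open>Approximants with errors \<open>inverse (Suc n)\<close> give continuity, while a single
  approximant within \<open>\<epsilon>/2\<close> controls the superlevel set at
  \<open>\<epsilon>\<close>. This later places the multiplier of a compact operator in
  \<open>C0U\<close>.\<close>

lemma C0_uniform_limit:
  assumes approx: "\<And>\<epsilon>. \<epsilon> > 0 \<Longrightarrow> \<exists>g\<in>C0 X. \<forall>x\<in>topspace X. cmod (f x - g x) \<le> \<epsilon>"
    and z: "\<And>x. x \<notin> topspace X \<Longrightarrow> f x = 0"
  shows "f \<in> C0 X"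
proof (rule C0I_compact)
  have "\<exists>g. g \<in> C0 X \<and> (\<forall>x\<in>topspace X. cmod (f x - g x) \<le> inverse (real (Suc n)))" for n
    using approx[of "inverse (real (Suc n))"] by auto
  then obtain g where g: "\<And>n. g n \<in> C0 X"
    and gf: "\<And>n x. x \<in> topspace X \<Longrightarrow> cmod (f x - g n x) \<le> inverse (real (Suc n))"
    by metis
  have "continuous_map X Met_TC.mtopology f"
  proof (rule Met_TC.continuous_map_uniform_limit[where F = sequentially and f = g])
    show "\<forall>\<^sub>F n in sequentially. continuous_map X Met_TC.mtopology (g n)"
      using C0D(1)[OF g] by simp
    fix \<epsilon> :: real assume "\<epsilon> > 0"
    then obtain N where N: "inverse (real (Suc N)) < \<epsilon>"
      using reals_Archimedean by blast
    have "dist (g n x) (f x) < \<epsilon>" if "n \<ge> N" "x \<in> topspace X" for n x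
    proof -
      have "inverse (real (Suc n)) \<le> inverse (real (Suc N))"
        using that by simp
      then show ?thesis
        using gf[OF that(2), of n] N by (simp only: dist_norm norm_minus_commute[of "g n x"])
    qed
    then show "\<forall>\<^sub>F n in sequentially. \<forall>x\<in>topspace X. f x \<in> UNIV \<and> dist (g n x) (f x) < \<epsilon>"
      unfolding eventually_sequentially by blast
  qed simp
  then show "continuous_map X euclidean f"
    by simp
  fix \<epsilon> :: real assume "\<epsilon> > 0"
  then obtain h where h: "h \<in> C0 X" "\<And>x. x \<in> topspace X \<Longrightarrow> cmod (f x - h x) \<le> \<epsilon>/2"
    using approx[of "\<epsilon>/2"] by auto
  have "\<epsilon>/2 \<le> cmod (h x)" if "x \<in> topspace X" "\<epsilon> \<le> cmod (f x)" for x
    using h(2)[OF that(1)] that(2) norm_triangle_ineq[of "f x - h x" "h x"] by simp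
  then show "\<exists>K. compactin X K \<and> {x \<in> topspace X. \<epsilon> \<le> cmod (f x)} \<subseteq> K"
    using C0D(2)[OF h(1), of "\<epsilon>/2"] \<open>\<epsilon> > 0\<close> by (intro exI[of _ "{x \<in> topspace X. \<epsilon>/2 \<le> cmod (h x)}"]) auto
qed (rule z)

text \<open>Continuity at the boundary of \<open>U\<close> is the issue. If \<open>W\<close> omits
  0, its preimage lies inside \<open>U\<close>; if \<open>W\<close> contains 0, the preimage also
  contains the complement of a compact superlevel set, which is open because \<open>X\<close> is
  Hausdorff.\<close>

lemma C0_subtopology_subset:
  assumes X: "Hausdorff_space X" and U: "openin X U"
  shows "C0 (subtopology X U) \<subseteq> C0 X"
proof
  fix f assume f: "f \<in> C0 (subtopology X U)"
  have UX: "U \<subseteq> topspace X" and top: "topspace (subtopology X U) = U"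
    using openin_subset[OF U] by auto
  have z: "f x = 0" if "x \<notin> U" for x
    using C0D(3)[OF f] that top by simp
  have K: "compactin X {x \<in> U. \<epsilon> \<le> cmod (f x)}" if "\<epsilon> > 0" for \<epsilon>
    using C0D(2)[OF f that] unfolding top by (simp add: compactin_subtopology)
  have set: "{x \<in> topspace X. \<epsilon> \<le> cmod (f x)} = {x \<in> U. \<epsilon> \<le> cmod (f x)}" if "\<epsilon> > 0" for \<epsilon>
    using z UX that by force
  have "openin X {x \<in> topspace X. f x \<in> W}" if W: "open W" for W
  proof -
    have o1: "openin X {x \<in> U. f x \<in> W}"
      using openin_continuous_map_preimage[OF C0D(1)[OF f], of W] W unfolding top
      by (simp add: openin_open_subtopology[OF U])
    show ?thesis
    proof (cases "0 \<in> W")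
      case False
      then have "{x \<in> topspace X. f x \<in> W} = {x \<in> U. f x \<in> W}"
        using z UX by force
      then show ?thesis
        using o1 by simp
    next
      case True
      then obtain \<epsilon> where \<epsilon>: "\<epsilon> > 0" "ball 0 \<epsilon> \<subseteq> W"
        using W openE by blast
      have "openin X (topspace X - {x \<in> U. \<epsilon> \<le> cmod (f x)})"
        using compactin_imp_closedin[OF X K[OF \<epsilon>(1)]] by blast
      moreover have "f x \<in> W" if "x \<notin> {x \<in> U. \<epsilon> \<le> cmod (f x)}" for x
        using that z[of x] \<epsilon> by (cases "x \<in> U") auto
      then have "{x \<in> topspace X. f x \<in> W} =
          {x \<in> U. f x \<in> W} \<union> (topspace X - {x \<in> U. \<epsilon> \<le> cmod (f x)})"
        using UX by blast
      ultimately show ?thesis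
        using o1 by auto
    qed
  qed
  then have "continuous_map X euclidean f"
    by (simp add: continuous_map)
  then show "f \<in> C0 X"
    using K z UX by (intro C0I_compact) (auto simp: set)
qed

section \<open>Pullbacks along homeomorphisms and bump functions\<close>

text \<open>The continuous inverse carries the compact superlevel sets of \<open>f\<close> onto
  compact sets enclosing those of the pullback. Both \<open>\<theta>\<close> and its inverse are
  instances.\<close>

lemma C0_pullback:
  assumes h: "homeomorphic_map Y Z h" and f: "f \<in> C0 Z"
  shows "(\<lambda>x. if x \<in> topspace Y then f (h x) else 0) \<in> C0 Y"
proof (rule C0I_compact)
  have "continuous_map Y euclidean (f \<circ> h)"
    using homeomorphic_imp_continuous_map[OF h] C0D(1)[OF f] by (rule continuous_map_compose)
  then show "continuous_map Y euclidean (\<lambda>x. if x \<in> topspace Y then f (h x) else 0)"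
    by (rule continuous_map_eq) auto
  fix \<epsilon> :: real assume "\<epsilon> > 0"
  obtain k where k: "homeomorphic_maps Y Z h k"
    using h homeomorphic_map_maps by blast
  then have "continuous_map Z Y k" and kh: "\<And>x. x \<in> topspace Y \<Longrightarrow> k (h x) = x"
    and hZ: "\<And>x. x \<in> topspace Y \<Longrightarrow> h x \<in> topspace Z"
    unfolding homeomorphic_maps_def using continuous_map_image_subset_topspace by blast+
  then have "compactin Y (k ` {x \<in> topspace Z. \<epsilon> \<le> cmod (f x)})"
    using C0D(2)[OF f \<open>\<epsilon> > 0\<close>] by (intro image_compactin)
  moreover have "x \<in> k ` {x \<in> topspace Z. \<epsilon> \<le> cmod (f x)}"
    if "x \<in> topspace Y" "\<epsilon> \<le> cmod (f (h x))" for x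
    using that kh hZ by (metis (mono_tags, lifting) image_eqI mem_Collect_eq)
  ultimately show "\<exists>K. compactin Y K \<and>
      {x \<in> topspace Y. \<epsilon> \<le> cmod (if x \<in> topspace Y then f (h x) else 0)} \<subseteq> K"
    by (intro exI[of _ "k ` {x \<in> topspace Z. \<epsilon> \<le> cmod (f x)}"]) auto
qed simp

text \<open>Locally compact Hausdorff spaces are completely regular, so \<open>x\<close> can be
  separated from the complement of an open neighbourhood contained in a compact set.\<close>

lemma C0_bump:
  assumes lc: "locally_compact_space Y" and H: "Hausdorff_space Y" and x: "x \<in> topspace Y"
  obtains \<zeta> where "\<zeta> \<in> C0 Y" and "\<zeta> x = 1" and "\<And>y. cmod (\<zeta> y) \<le> 1"
proof -
  obtain G K where G: "openin Y G" "compactin Y K" "x \<in> G" "G \<subseteq> K"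
    using lc x unfolding locally_compact_space_def by blast
  have "completely_regular_space Y"
    using lc H locally_compact_regular_imp_completely_regular_space by blast
  then obtain f :: "_ \<Rightarrow> real" where f: "continuous_map Y (top_of_set {0..1}) f" "f x = 0"
    and f1: "f ` (topspace Y - G) \<subseteq> {1}"
    unfolding completely_regular_space_def using G x
    by (metis Diff_iff closedin_diff closedin_topspace)
  have fc: "continuous_map Y euclidean f" and f01: "\<And>y. y \<in> topspace Y \<Longrightarrow> f y \<in> {0..1}"
    using f by (auto simp: continuous_map_in_subtopology)
  \<comment> \<open>The separating function \<open>f\<close> is 0 at \<open>x\<close> and 1 off
    \<open>G\<close>; passing to \<open>1 - f\<close> exchanges these values, so
    \<open>\<zeta>\<close> vanishes off \<open>G\<close> and hence off the compact set
    \<open>K\<close>.\<close>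
  define \<zeta> where "\<zeta> y = (if y \<in> topspace Y then complex_of_real (1 - f y) else 0)" for y
  have "continuous_map Y euclidean (\<lambda>y. complex_of_real (1 - f y))"
    using fc by (simp add: continuous_map_atin tendsto_diff tendsto_of_real)
  then have "continuous_map Y euclidean \<zeta>"
    by (rule continuous_map_eq) (simp add: \<zeta>_def)
  moreover have "\<zeta> y = 0" if "y \<notin> G" for y
    using that f1 by (auto simp: \<zeta>_def)
  then have "{y \<in> topspace Y. \<epsilon> \<le> cmod (\<zeta> y)} \<subseteq> K" if "\<epsilon> > 0" for \<epsilon>
    using G(4) that by force
  ultimately have "\<zeta> \<in> C0 Y"
    using G(2) by (intro C0I_compact exI[of _ K]) (auto simp: \<zeta>_def)
  moreover have "cmod (\<zeta> y) \<le> 1" for y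
  proof (cases "y \<in> topspace Y")
    case True
    then have "cmod (\<zeta> y) = \<bar>1 - f y\<bar>"
      unfolding \<zeta>_def by (simp only: if_True norm_of_real)
    then show ?thesis
      using f01[OF True] by auto
  qed (simp add: \<zeta>_def)
  ultimately show ?thesis
    using that x f(2) by (auto simp: \<zeta>_def)
qed

section \<open>C*-algebras and homomorphisms\<close>

text \<open>The difference \<open>z\<close> is annihilated on the left by the adjoints of both
  \<open>x\<close> and \<open>y\<close>, so its adjoint times \<open>z\<close> is zero, and the
  C*-identity forces \<open>z\<close> to vanish.\<close>

lemma (in cstar_algebra) eq_if_star_mult_eq:
  assumes x: "x \<in> carr A" and y: "y \<in> carr A"
    and w: "x\<^sup>\<star> \<otimes> x = w" "x\<^sup>\<star> \<otimes> y = w" "y\<^sup>\<star> \<otimes> x = w" "y\<^sup>\<star> \<otimes> y = w"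
  shows "x = y"
proof -
  define z where "z = x \<oplus> (-1) \<odot> y"
  have wc: "w \<in> carr A"
    using w(1) x by (metis mult_closed star_closed)
  have ny: "(-1) \<odot> y \<in> carr A" and zc: "z \<in> carr A"
    using x y by (auto simp: z_def add_closed scale_closed)
  have "x\<^sup>\<star> \<otimes> z = w \<oplus> (-1) \<odot> w" "y\<^sup>\<star> \<otimes> z = w \<oplus> (-1) \<odot> w"
    using x y ny w by (simp_all add: z_def mult_add_right mult_scale_right star_closed)
  then have xz: "x\<^sup>\<star> \<otimes> z = \<zero>" "y\<^sup>\<star> \<otimes> z = \<zero>"
    using add_inverse[OF wc] by simp_all
  have "z\<^sup>\<star> = x\<^sup>\<star> \<oplus> (-1) \<odot> y\<^sup>\<star>"
    using x y ny by (simp add: z_def star_add star_scale)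
  then have "z\<^sup>\<star> \<otimes> z = x\<^sup>\<star> \<otimes> z \<oplus> (-1) \<odot> (y\<^sup>\<star> \<otimes> z)"
    using x y zc by (simp add: mult_add_left mult_scale_left star_closed scale_closed)
  also have "\<dots> = \<zero>"
    using xz add_inverse[OF zero_closed] by simp
  finally have "\<parallel>z\<parallel>\<^sup>2 = 0"
    using norm_star_mult[OF zc] norm_eq_0[OF zero_closed] by simp
  then have "z = \<zero>"
    using norm_eq_0[OF zc] by simp
  have "x = x \<oplus> (y \<oplus> (-1) \<odot> y)"
    using x y by (simp add: add_inverse add_zero)
  also have "\<dots> = z \<oplus> y"
    unfolding z_def using x y ny by (metis add_assoc add_commute)
  also have "\<dots> = y"
    using \<open>z = \<zero>\<close> y zero_closed by (metis add_commute add_zero)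
  finally show ?thesis .
qed

lemma star_homD:
  assumes "star_hom A B \<phi>"
  shows "\<And>x. x \<in> carr A \<Longrightarrow> \<phi> x \<in> carr B"
    and "\<And>x y. \<lbrakk>x \<in> carr A; y \<in> carr A\<rbrakk> \<Longrightarrow> \<phi> (x \<oplus>\<^bsub>A\<^esub> y) = \<phi> x \<oplus>\<^bsub>B\<^esub> \<phi> y"
    and "\<And>c x. x \<in> carr A \<Longrightarrow> \<phi> (c \<odot>\<^bsub>A\<^esub> x) = c \<odot>\<^bsub>B\<^esub> \<phi> x"
    and "\<And>x y. \<lbrakk>x \<in> carr A; y \<in> carr A\<rbrakk> \<Longrightarrow> \<phi> (x \<otimes>\<^bsub>A\<^esub> y) = \<phi> x \<otimes>\<^bsub>B\<^esub> \<phi> y"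
    and "\<And>x. x \<in> carr A \<Longrightarrow> \<phi> (x\<^sup>\<star>\<^bsub>A\<^esub>) = (\<phi> x)\<^sup>\<star>\<^bsub>B\<^esub>"
  using assms by (auto simp: star_hom_def)

lemma star_hom_C0D:
  assumes "star_hom (C0_alg X) B \<phi>"
  shows "\<And>f. f \<in> C0 X \<Longrightarrow> \<phi> f \<in> carr B"
    and "\<And>f g. \<lbrakk>f \<in> C0 X; g \<in> C0 X\<rbrakk> \<Longrightarrow> \<phi> (\<lambda>x. f x + g x) = \<phi> f \<oplus>\<^bsub>B\<^esub> \<phi> g"
    and "\<And>c f. f \<in> C0 X \<Longrightarrow> \<phi> (\<lambda>x. c * f x) = c \<odot>\<^bsub>B\<^esub> \<phi> f"
    and "\<And>f g. \<lbrakk>f \<in> C0 X; g \<in> C0 X\<rbrakk> \<Longrightarrow> \<phi> (\<lambda>x. f x * g x) = \<phi> f \<otimes>\<^bsub>B\<^esub> \<phi> g"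
    and "\<And>f. f \<in> C0 X \<Longrightarrow> \<phi> (\<lambda>x. cnj (f x)) = (\<phi> f)\<^sup>\<star>\<^bsub>B\<^esub>"
  using star_homD[OF assms] by (simp_all add: C0_alg_def)

text \<open>Restricting to the carrier makes the composite extensional, as the uniqueness clauses of
  the universal properties demand.\<close>

lemma star_hom_compose:
  assumes A: "cstar_algebra A" and "star_hom A B \<phi>" and "star_hom B C \<psi>"
  shows "star_hom A C (restrict (\<psi> \<circ> \<phi>) (carr A))"
  using assms cstar_algebra.add_closed[OF A] cstar_algebra.scale_closed[OF A]
    cstar_algebra.mult_closed[OF A] cstar_algebra.star_closed[OF A]
  by (simp add: star_hom_def)

lemma star_hom_id:
  assumes "cstar_algebra A" shows "star_hom A A (restrict id (carr A))"
  using cstar_algebra.add_closed[OF assms] cstar_algebra.scale_closed[OF assms]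
    cstar_algebra.mult_closed[OF assms] cstar_algebra.star_closed[OF assms]
  by (simp add: star_hom_def)

lemma star_isoI:
  assumes "star_hom A B \<phi>" and "star_hom B A \<psi>"
    and "\<And>x. x \<in> carr A \<Longrightarrow> \<psi> (\<phi> x) = x" and "\<And>y. y \<in> carr B \<Longrightarrow> \<phi> (\<psi> y) = y"
  shows "star_iso A B \<phi>"
  unfolding star_iso_def using assms star_homD(1)[OF assms(1)] star_homD(1)[OF assms(2)]
  by (auto intro!: bij_betw_byWitness[where f' = \<psi>])

section \<open>The graph of a partial homeomorphism\<close>

locale partial_homeo =
  fixes X :: "'x topology" and U V :: "'x set" and \<sigma> :: "'x \<Rightarrow> 'x"
  assumes lc: "locally_compact_space X" and Hausdorff: "Hausdorff_space X"
    and partial: "partial_homeomorphism X U V \<sigma>"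
begin

abbreviation "E \<equiv> partial_homeo_graph X U \<sigma>"
abbreviation "C0U \<equiv> C0 (subtopology X U)"
abbreviation "C0V \<equiv> C0 (subtopology X V)"
abbreviation "\<theta> \<equiv> push U V \<sigma>"

text \<open>On \<open>C0V\<close> this is the inverse of \<open>\<theta>\<close>. It is also applied
  to arbitrary \<open>f\<close> in \<open>C0 X\<close>, where it describes the left action and need
  not vanish at infinity on \<open>U\<close>.\<close>

definition pull :: "('x \<Rightarrow> complex) \<Rightarrow> 'x \<Rightarrow> complex"
  where "pull g = (\<lambda>x. if x \<in> U then g (\<sigma> x) else 0)"

definition mult_op :: "('x \<Rightarrow> complex) \<Rightarrow> ('x \<Rightarrow> complex) \<Rightarrow> 'x \<Rightarrow> complex"
  where "mult_op k = (\<lambda>\<zeta>\<in>C0U. \<lambda>x. k x * \<zeta> x)"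

text \<open>For compact operators the description is meaningful: existence of \<open>k\<close> is
  \<open>compact_ops_eq\<close>, uniqueness is \<open>mult_op_inject\<close>.\<close>

definition symbol :: "(('x \<Rightarrow> complex) \<Rightarrow> 'x \<Rightarrow> complex) \<Rightarrow> 'x \<Rightarrow> complex"
  where "symbol T = (THE k. k \<in> C0U \<and> T = mult_op k)"

lemma open_U: "openin X U" and open_V: "openin X V"
  and hom: "homeomorphic_map (subtopology X U) (subtopology X V) \<sigma>"
  using partial by (auto simp: partial_homeomorphism_def)

lemma U_subset: "U \<subseteq> topspace X" and V_subset: "V \<subseteq> topspace X"
  using open_U open_V openin_subset by auto

text \<open>The general simplification rule is switched off right after this, so that carriers are
  rewritten to \<open>U\<close> and \<open>V\<close> instead of intersections.\<close>

lemma topspace_U [simp]: "topspace (subtopology X U) = U"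
  and topspace_V [simp]: "topspace (subtopology X V) = V"
  using U_subset V_subset by auto

declare topspace_subtopology [simp del]

lemma inj_on_U: "inj_on \<sigma> U" and image_U: "\<sigma> ` U = V"
  using homeomorphic_imp_injective_map[OF hom] homeomorphic_imp_surjective_map[OF hom] by simp_all

lemma C0U_subset: "C0U \<subseteq> C0 X" and C0V_subset: "C0V \<subseteq> C0 X"
  using C0_subtopology_subset[OF Hausdorff] open_U open_V by auto

lemma C0U_outside: "\<xi> \<in> C0U \<Longrightarrow> x \<notin> U \<Longrightarrow> \<xi> x = 0"
  and C0V_outside: "g \<in> C0V \<Longrightarrow> x \<notin> V \<Longrightarrow> g x = 0"
  using C0D(3)[of \<xi> "subtopology X U" x] C0D(3)[of g "subtopology X V" x] by simp_all

text \<open>An element of \<open>C0 X\<close> restricts to a bounded continuous function on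
  \<open>W\<close>, so functions vanishing at infinity on \<open>W\<close> form an ideal.\<close>

lemma C0_mult_ideal:
  assumes W: "openin X W" and f: "f \<in> C0 X" and g: "g \<in> C0 (subtopology X W)"
  shows "(\<lambda>x. f x * g x) \<in> C0 (subtopology X W)"
  using C0_bounded[OF f] C0_mult[OF continuous_map_from_subtopology[OF C0D(1)[OF f]] _ g] by metis

section \<open>The map \<open>\<theta>\<close> and its inverse\<close>

lemma pull_C0:
  assumes "g \<in> C0V" shows "pull g \<in> C0U"
  using C0_pullback[OF hom assms] by (simp add: pull_def)

text \<open>By injectivity the continuous inverse \<open>k\<close> agrees on \<open>V\<close> with
  \<open>inv_into U \<sigma>\<close>, so \<open>\<theta> f\<close> is a pullback along
  \<open>k\<close>.\<close>

lemma push_C0: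
  assumes "f \<in> C0U" shows "\<theta> f \<in> C0V"
proof -
  obtain k where k: "homeomorphic_maps (subtopology X U) (subtopology X V) \<sigma> k"
    using hom homeomorphic_map_maps by blast
  then have hk: "homeomorphic_map (subtopology X V) (subtopology X U) k"
    using homeomorphic_maps_sym homeomorphic_map_maps by blast
  have "inv_into U \<sigma> x = k x" if "x \<in> V" for x
  proof (rule inv_into_f_eq[OF inj_on_U])
    show "k x \<in> U"
      using homeomorphic_imp_surjective_map[OF hk] that by auto
    show "\<sigma> (k x) = x"
      using k that by (simp add: homeomorphic_maps_def)
  qed
  then show ?thesis
    using C0_pullback[OF hk assms] by (simp add: push_def cong: if_cong)
qed

lemma push_at_image [simp]: "x \<in> U \<Longrightarrow> \<theta> f (\<sigma> x) = f x"
  using image_U inj_on_U by (auto simp: push_def)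

lemma pull_push: "f \<in> C0U \<Longrightarrow> pull (\<theta> f) = f"
  by (auto simp: pull_def C0U_outside)

lemma push_pull:
  assumes "g \<in> C0V" shows "\<theta> (pull g) = g"
proof
  fix x show "\<theta> (pull g) x = g x"
  proof (cases "x \<in> V")
    case True
    then obtain u where "u \<in> U" "x = \<sigma> u"
      using image_U by blast
    then show ?thesis
      by (simp add: pull_def)
  qed (simp add: push_def C0V_outside[OF assms])
qed

text \<open>Covariant pairs are defined with an inverse of \<open>\<theta>\<close> obtained by
  choice; here it becomes an explicit formula.\<close>

lemma inv_push:
  assumes "g \<in> C0V" shows "inv_into C0U \<theta> g = pull g"
proof (rule inv_into_f_eq)
  show "inj_on \<theta> C0U"
    by (rule inj_on_inverseI[of _ pull]) (rule pull_push)
qed (use assms pull_C0 push_pull in auto)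

section \<open>The Hilbert module and the regular vertices\<close>

lemma Cd_eq: "Cd E = C0U"
  using Hausdorff open_U by (rule Cd_partial_homeo_graph)

lemma inner_eq: "\<xi> \<in> C0U \<Longrightarrow> inner_d E \<xi> \<eta> = (\<lambda>x. cnj (\<xi> x) * \<eta> x)"
  using open_U C0U_outside by (intro inner_d_partial_homeo_graph) auto

lemma graph_simps [simp]: "E0 E = X" "E1 E = subtopology X U" "dom_map E = (\<lambda>x. x)" "ran_map E = \<sigma>"
  by (simp_all add: partial_homeo_graph_def)

text \<open>For a neighbourhood \<open>W\<close> as in the definition of \<open>E0_fin\<close>, the set \<open>V \<inter> W\<close> is the image of the
  compact set \<open>\<sigma>\<inverse>(W)\<close>, hence closed, so that a boundary point of \<open>V\<close> is never regular.\<close>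

lemma E0_rg_eq: "E0_rg E = V"
proof (intro equalityI subsetI)
  fix v assume "v \<in> E0_rg E"
  then obtain W G where "v \<in> topspace X" and W: "W \<subseteq> topspace X" and G: "openin X G" "v \<in> G" "G \<subseteq> W"
    and K: "compactin (subtopology X U) {e \<in> U. \<sigma> e \<in> W}"
    and sce: "v \<notin> X closure_of (topspace X - X closure_of V)"
    by (auto simp: E0_rg_def E0_fin_def E0_sce_def image_U)
  have "compactin X (\<sigma> ` {e \<in> U. \<sigma> e \<in> W})"
    using image_compactin[OF K homeomorphic_imp_continuous_map[OF hom]]
    by (simp add: compactin_subtopology)
  moreover have "\<sigma> ` {e \<in> U. \<sigma> e \<in> W} = V \<inter> W"
    using image_U by auto
  ultimately have closed: "closedin X (V \<inter> W)"
    using compactin_imp_closedin[OF Hausdorff] by simp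
  \<comment> \<open>Being outside the closure of the sources, \<open>v\<close> is not a source
    itself, and the sources are the complement of the closure of \<open>V\<close>.\<close>
  have "v \<in> X closure_of V"
    using sce \<open>v \<in> topspace X\<close> closure_of_subset[OF Diff_subset, of X "X closure_of V"] by blast
  \<comment> \<open>Membership in a closure is local: it may be tested inside the open neighbourhood
    \<open>G\<close> of \<open>v\<close>.\<close>
  then have "v \<in> X closure_of (V \<inter> W)"
    using G openin_Int_closure_of_subset[OF G(1), of V] closure_of_mono[of "G \<inter> V" "V \<inter> W" X] by blast
  then show "v \<in> V"
    using closed closure_of_closedin by fastforce
next
  fix v assume v: "v \<in> V"
  have "locally_compact_space (subtopology X V)"
    using lc Hausdorff open_V by (simp add: locally_compact_space_open_subset)
  then obtain G W where G: "openin (subtopology X V) G" "compactin (subtopology X V) W" "v \<in> G" "G \<subseteq> W"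
    using v unfolding locally_compact_space_def topspace_V by metis
  obtain k where k: "homeomorphic_maps (subtopology X U) (subtopology X V) \<sigma> k"
    using hom homeomorphic_map_maps by blast
  have "compactin (subtopology X U) (k ` W)"
    using k G(2) by (intro image_compactin) (auto simp: homeomorphic_maps_def)
  moreover have "W \<subseteq> V"
    using compactin_subset_topspace[OF G(2)] by simp
  \<comment> \<open>The edges over the compact neighbourhood \<open>W\<close> are its image under
    the continuous inverse \<open>k\<close>, so they form a compact set, as \<open>E0_fin\<close>
    requires.\<close>
  moreover have "{e \<in> U. \<sigma> e \<in> W} = k ` W"
  proof (intro equalityI subsetI)
    fix e assume "e \<in> {e \<in> U. \<sigma> e \<in> W}"
    then show "e \<in> k ` W"
      using k by (force simp: homeomorphic_maps_def)
  next
    fix e assume "e \<in> k ` W"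
    then obtain w where w: "w \<in> W" "e = k w"
      by blast
    then have "w \<in> V"
      using \<open>W \<subseteq> V\<close> by blast
    moreover have "k \<in> V \<rightarrow> U"
      using k continuous_map_funspace[of "subtopology X V" "subtopology X U" k]
      by (simp add: homeomorphic_maps_def)
    ultimately show "e \<in> {e \<in> U. \<sigma> e \<in> W}"
      using k w by (auto simp: homeomorphic_maps_def)
  qed
  moreover have "openin X G"
    using G(1) open_V openin_trans_full by blast
  ultimately have "v \<in> E0_fin E"
    using G V_subset v unfolding E0_fin_def graph_simps topspace_U mem_Collect_eq
    by (intro conjI, blast) (rule exI[of _ W], auto)
  \<comment> \<open>An open set that misses the sources also misses their closure.\<close>
  moreover have "V \<inter> (topspace X - X closure_of V) = {}"
    using closure_of_subset[OF V_subset] by blast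
  then have "v \<notin> X closure_of (E0_sce E)"
    using v open_V unfolding E0_sce_def by (auto simp: in_closure_of image_U)
  ultimately show "v \<in> E0_rg E"
    by (simp add: E0_rg_def)
qed

section \<open>Compact operators as multiplication operators\<close>

lemma pi_r_eq: "pi_r E f = mult_op (pull f)"
  by (auto simp: pi_r_def mult_op_def Cd_eq pull_def C0U_outside fun_eq_iff)

text \<open>The domain map is an inclusion, so fibres have at most one point and both the inner
  product and the right action are pointwise.\<close>

lemma rank_one_eq: "\<eta> \<in> C0U \<Longrightarrow> rank_one E \<xi> \<eta> = mult_op (\<lambda>x. \<xi> x * cnj (\<eta> x))"
  by (simp add: rank_one_def act_right_def mult_op_def Cd_eq inner_eq mult.assoc)

lemma mult_op_closed:
  assumes "k \<in> C0U" "\<zeta> \<in> C0U" shows "mult_op k \<zeta> \<in> C0U"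
  using C0_mult_C0[OF assms] assms(2) by (simp add: mult_op_def)

lemma bump:
  assumes "x \<in> U"
  obtains \<zeta> where "\<zeta> \<in> C0U" "\<zeta> x = 1" "\<And>y. cmod (\<zeta> y) \<le> 1"
proof (rule C0_bump)
  show "locally_compact_space (subtopology X U)"
    using lc Hausdorff open_U by (simp add: locally_compact_space_open_subset)
  show "Hausdorff_space (subtopology X U)"
    using Hausdorff by (rule Hausdorff_space_subtopology)
qed (use assms in auto)

text \<open>Evaluating on a bump function with value 1 at \<open>x\<close> recovers the multiplier
  at \<open>x\<close>.\<close>

lemma mult_op_inject:
  assumes k: "k \<in> C0U" "k' \<in> C0U" and eq: "mult_op k = mult_op k'"
  shows "k = k'"
proof
  fix x show "k x = k' x"
  proof (cases "x \<in> U")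
    case True
    then obtain \<zeta> where \<zeta>: "\<zeta> \<in> C0U" "\<zeta> x = 1"
      using bump by metis
    have "mult_op k \<zeta> x = mult_op k' \<zeta> x"
      using eq by simp
    then show ?thesis
      using \<zeta> by (simp add: mult_op_def)
  qed (simp add: C0U_outside k)
qed

lemma symbol_mult_op: "k \<in> C0U \<Longrightarrow> symbol (mult_op k) = k"
  unfolding symbol_def using mult_op_inject by blast

lemma norm_d_eq: "\<xi> \<in> C0U \<Longrightarrow> norm_d E \<xi> = sqrt (SUP x. (cmod (\<xi> x))\<^sup>2)"
  by (simp add: norm_d_def sup_norm_def inner_eq norm_mult power2_eq_square)

text \<open>The module norm is a supremum norm. Boundedness of \<open>\<xi>\<close> has to be
  supplied, because a real supremum bounds its members only when the set is bounded above.\<close>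

lemma cmod_le_norm_d:
  assumes \<xi>: "\<xi> \<in> C0U" shows "cmod (\<xi> x) \<le> norm_d E \<xi>"
proof -
  obtain M where "\<And>x. cmod (\<xi> x) \<le> M"
    using C0_bounded[OF \<xi>] by blast
  then have "bdd_above (range (\<lambda>x. (cmod (\<xi> x))\<^sup>2))"
    by (intro bdd_aboveI[of _ "M\<^sup>2"]) (auto intro: power_mono)
  then have "(cmod (\<xi> x))\<^sup>2 \<le> (SUP x. (cmod (\<xi> x))\<^sup>2)"
    by (rule cSUP_upper[rotated]) simp
  then show ?thesis
    by (simp add: norm_d_eq[OF \<xi>] real_le_rsqrt)
qed

text \<open>Applied to bump functions: testing an operator on one of them costs no extra
  factor.\<close>

lemma norm_d_le_1:
  assumes \<xi>: "\<xi> \<in> C0U" and "\<And>x. cmod (\<xi> x) \<le> 1" shows "norm_d E \<xi> \<le> 1"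
proof -
  have "(SUP x. (cmod (\<xi> x))\<^sup>2) \<le> 1"
    using assms by (intro cSUP_least) (auto simp: power_le_one)
  then show ?thesis
    by (simp add: norm_d_eq[OF \<xi>])
qed

lemma finite_rank_eq:
  assumes "S \<in> finite_rank E"
  obtains k where "k \<in> C0U" and "S = mult_op k"
proof -
  obtain n :: nat and c \<xi> \<eta> where S: "S = (\<lambda>\<zeta>\<in>C0U. \<lambda>e. \<Sum>i<n. c i * rank_one E (\<xi> i) (\<eta> i) \<zeta> e)"
    and mem: "\<And>i. i < n \<Longrightarrow> \<xi> i \<in> C0U \<and> \<eta> i \<in> C0U"
    using assms unfolding finite_rank_def Cd_eq by blast
  have "(\<lambda>x. \<Sum>i<n. c i * (\<xi> i x * cnj (\<eta> i x))) \<in> C0U"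
    using mem by (intro C0_sum C0_scale C0_mult_C0 C0_cnj) auto
  moreover have "S = mult_op (\<lambda>x. \<Sum>i<n. c i * (\<xi> i x * cnj (\<eta> i x)))"
    using mem by (auto simp: S mult_op_def rank_one_eq sum_distrib_right mult.assoc fun_eq_iff
        intro!: sum.cong)
  ultimately show ?thesis
    by (rule that)
qed

text \<open>The multiplier is recovered by evaluating \<open>T\<close> on bump functions, \<open>\<kappa> x = T (b x) x\<close>; the multipliers
  of the approximating finite rank operators converge to it uniformly.\<close>

lemma compact_ops_eq:
  assumes T: "T \<in> compact_ops E"
  obtains k where "k \<in> C0U" and "T = mult_op k"
proof -
  have TE: "T \<in> C0U \<rightarrow>\<^sub>E C0U"
    using T by (auto simp: compact_ops_def adjointable_def is_adjoint_def Cd_eq)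
  \<comment> \<open>Approximation in operator norm by finite rank operators becomes a pointwise
    estimate against multiplication operators.\<close>
  have approx: "\<exists>k\<in>C0U. \<forall>\<zeta>\<in>C0U. \<forall>x. cmod (T \<zeta> x - k x * \<zeta> x) \<le> \<epsilon> * norm_d E \<zeta>" if \<epsilon>: "\<epsilon> > 0" for \<epsilon>
  proof -
    obtain S where S: "S \<in> finite_rank E"
      and le: "\<And>\<zeta>. \<zeta> \<in> C0U \<Longrightarrow> norm_d E (\<lambda>e. T \<zeta> e - S \<zeta> e) \<le> \<epsilon> * norm_d E \<zeta>"
      using T \<epsilon> unfolding compact_ops_def Cd_eq by blast
    obtain k where k: "k \<in> C0U" "S = mult_op k"
      using finite_rank_eq[OF S] by blast
    have "cmod (T \<zeta> x - k x * \<zeta> x) \<le> \<epsilon> * norm_d E \<zeta>" if \<zeta>: "\<zeta> \<in> C0U" for \<zeta> x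
    proof -
      have "(\<lambda>x. T \<zeta> x + (-1) * (k x * \<zeta> x)) \<in> C0U"
        using TE \<zeta> k by (intro C0_add C0_scale C0_mult_C0) auto
      then have "cmod (T \<zeta> x - k x * \<zeta> x) \<le> norm_d E (\<lambda>x. T \<zeta> x - k x * \<zeta> x)"
        using cmod_le_norm_d by fastforce
      also have "\<dots> \<le> \<epsilon> * norm_d E \<zeta>"
        using le[OF \<zeta>] \<zeta> by (simp add: k(2) mult_op_def)
      finally show ?thesis .
    qed
    then show ?thesis
      using k(1) by blast
  qed
  have "\<exists>\<zeta>. \<zeta> \<in> C0U \<and> \<zeta> x = 1 \<and> (\<forall>y. cmod (\<zeta> y) \<le> 1)" if "x \<in> U" for x
    using bump[OF that] by metis
  then obtain b where b: "\<And>x. x \<in> U \<Longrightarrow> b x \<in> C0U" "\<And>x. x \<in> U \<Longrightarrow> b x x = 1"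
    "\<And>x y. x \<in> U \<Longrightarrow> cmod (b x y) \<le> 1"
    by metis
  define \<kappa> where "\<kappa> x = (if x \<in> U then T (b x) x else 0)" for x
  \<comment> \<open>The function \<open>b x\<close> has norm at most 1 and value 1 at
    \<open>x\<close>, so the bound does not depend on \<open>x\<close>; this is uniform convergence
    to \<open>\<kappa>\<close>.\<close>
  have close: "cmod (\<kappa> x - k x) \<le> \<epsilon>"
    if \<epsilon>: "\<epsilon> > 0" and le: "\<forall>\<zeta>\<in>C0U. \<forall>x. cmod (T \<zeta> x - k x * \<zeta> x) \<le> \<epsilon> * norm_d E \<zeta>" and x: "x \<in> U" for \<epsilon> k x
  proof -
    have "cmod (T (b x) x - k x * b x x) \<le> \<epsilon> * norm_d E (b x)"
      using le b(1)[OF x] by blast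
    also have "\<dots> \<le> \<epsilon> * 1"
      using norm_d_le_1[OF b(1,3)[OF x]] \<epsilon> x by (intro mult_left_mono) auto
    finally show ?thesis
      using x by (simp add: \<kappa>_def b)
  qed
  have \<kappa>: "\<kappa> \<in> C0U"
  proof (rule C0_uniform_limit)
    fix \<epsilon> :: real assume "\<epsilon> > 0"
    then show "\<exists>k\<in>C0U. \<forall>x\<in>topspace (subtopology X U). cmod (\<kappa> x - k x) \<le> \<epsilon>"
      using approx close by (metis topspace_U)
  qed (simp add: \<kappa>_def)
  have "T \<zeta> x = \<kappa> x * \<zeta> x" if \<zeta>: "\<zeta> \<in> C0U" for \<zeta> x
  proof (cases "x \<in> U")
    case True
    have "cmod (T \<zeta> x - \<kappa> x * \<zeta> x) \<le> 0"
    proof (rule field_le_epsilon)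
      fix e :: real assume e: "e > 0"
      \<comment> \<open>Two errors of size \<open>e / N * norm_d E \<zeta>\<close> arise, one from
        \<open>T\<close> and one from \<open>\<kappa>\<close>; adding 1 keeps \<open>N\<close>
        positive when the norm is 0.\<close>
      define N where "N = 2 * norm_d E \<zeta> + 1"
      have N: "N > 0" and \<zeta>N: "cmod (\<zeta> x) \<le> norm_d E \<zeta>"
        using cmod_le_norm_d[OF \<zeta>, of x] norm_ge_zero[of "\<zeta> x"] unfolding N_def by linarith+
      then have eN: "e / N > 0"
        using e by simp
      obtain k where k: "\<forall>\<zeta>\<in>C0U. \<forall>x. cmod (T \<zeta> x - k x * \<zeta> x) \<le> e / N * norm_d E \<zeta>"
        using approx[OF eN] by blast
      have "T \<zeta> x - \<kappa> x * \<zeta> x = (T \<zeta> x - k x * \<zeta> x) - (\<kappa> x - k x) * \<zeta> x"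
        by (simp add: algebra_simps)
      then have "cmod (T \<zeta> x - \<kappa> x * \<zeta> x) \<le> cmod (T \<zeta> x - k x * \<zeta> x) + cmod (\<kappa> x - k x) * cmod (\<zeta> x)"
        by (metis norm_triangle_ineq4 norm_mult)
      also have "\<dots> \<le> e / N * norm_d E \<zeta> + e / N * norm_d E \<zeta>"
        using k \<zeta> close[OF eN k True] \<zeta>N eN by (intro add_mono mult_mono) auto
      also have "\<dots> \<le> e / N * N"
        using eN by (simp only: N_def distrib_left[symmetric] mult_le_cancel_left_pos)
      finally show "cmod (T \<zeta> x - \<kappa> x * \<zeta> x) \<le> 0 + e"
        using N by simp
    qed
    then show ?thesis
      by simp
  next
    case False
    have "T \<zeta> \<in> C0U"
      using TE \<zeta> by auto
    then show ?thesis
      using False \<zeta> by (simp add: C0U_outside)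
  qed
  then have "T = mult_op \<kappa>"
    using TE by (intro extensionalityI[of _ C0U]) (auto simp: mult_op_def PiE_def)
  with \<kappa> show ?thesis
    by (rule that)
qed

text \<open>Pairing with a bump function at \<open>x\<close> determines any adjoint at
  \<open>x\<close>. The equivalence thus evaluates the definite description behind the star of
  \<open>compact_alg\<close>.\<close>

lemma is_adjoint_mult_op_iff:
  assumes k: "k \<in> C0U"
  shows "is_adjoint E (mult_op k) S \<longleftrightarrow> S = mult_op (\<lambda>x. cnj (k x))"
proof
  assume S: "is_adjoint E (mult_op k) S"
  then have SE: "S \<in> C0U \<rightarrow>\<^sub>E C0U"
    and adj: "\<And>\<xi> \<eta>. \<xi> \<in> C0U \<Longrightarrow> \<eta> \<in> C0U \<Longrightarrow> inner_d E (mult_op k \<xi>) \<eta> = inner_d E \<xi> (S \<eta>)"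
    by (auto simp: is_adjoint_def Cd_eq)
  have "S \<eta> x = cnj (k x) * \<eta> x" if \<eta>: "\<eta> \<in> C0U" for \<eta> x
  proof (cases "x \<in> U")
    case True
    then obtain \<zeta> where \<zeta>: "\<zeta> \<in> C0U" "\<zeta> x = 1"
      using bump by metis
    have "inner_d E (mult_op k \<zeta>) \<eta> x = inner_d E \<zeta> (S \<eta>) x"
      using adj[OF \<zeta>(1) \<eta>] by simp
    then show ?thesis
      using \<zeta> by (simp add: inner_eq mult_op_closed[OF k]) (simp add: mult_op_def)
  next
    case False
    have "S \<eta> \<in> C0U"
      using SE \<eta> by auto
    then show ?thesis
      using False \<eta> by (simp add: C0U_outside)
  qed
  then show "S = mult_op (\<lambda>x. cnj (k x))"
    using SE by (intro extensionalityI[of _ C0U]) (auto simp: mult_op_def PiE_def)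
next
  assume S: "S = mult_op (\<lambda>x. cnj (k x))"
  have "mult_op j \<in> C0U \<rightarrow>\<^sub>E C0U" if "j \<in> C0U" for j
    using mult_op_closed[OF that] by (auto simp: mult_op_def)
  moreover have "inner_d E (mult_op k \<xi>) \<eta> = inner_d E \<xi> (mult_op (\<lambda>x. cnj (k x)) \<eta>)"
    if "\<xi> \<in> C0U" "\<eta> \<in> C0U" for \<xi> \<eta>
    using that by (simp add: inner_eq mult_op_closed[OF k]) (simp add: mult_op_def mult.assoc mult.left_commute)
  ultimately show "is_adjoint E (mult_op k) S"
    using k C0_cnj[OF k] by (simp add: is_adjoint_def Cd_eq S)
qed

section \<open>Both kinds of pairs in explicit form\<close>

lemma covariant_pair_iff:
  "covariant_pair X U V \<theta> B R0 R1 \<longleftrightarrow>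
    star_hom (C0_alg X) B R0 \<and> linear_into C0V B R1 \<and>
    (\<forall>f\<in>C0 X. \<forall>g\<in>C0V. R0 f \<otimes>\<^bsub>B\<^esub> R1 g = R1 (\<lambda>x. f x * g x)) \<and>
    (\<forall>f\<in>C0 X. \<forall>g\<in>C0V. R1 g \<otimes>\<^bsub>B\<^esub> R0 f = R1 (\<theta> (\<lambda>x. pull g x * f x))) \<and>
    (\<forall>g\<in>C0V. \<forall>h\<in>C0V. R1 g \<otimes>\<^bsub>B\<^esub> (R1 h)\<^sup>\<star>\<^bsub>B\<^esub> = R0 (\<lambda>x. g x * cnj (h x))) \<and>
    (\<forall>g\<in>C0V. \<forall>h\<in>C0V. (R1 g)\<^sup>\<star>\<^bsub>B\<^esub> \<otimes>\<^bsub>B\<^esub> R1 h = R0 (pull (\<lambda>x. cnj (g x) * h x)))"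
  by (simp add: covariant_pair_def Let_def inv_push C0_mult_C0 C0_cnj)

lemma toeplitz_pair_iff:
  "toeplitz_pair E A T0 T1 \<longleftrightarrow>
    star_hom (C0_alg X) A T0 \<and> linear_into C0U A T1 \<and>
    (\<forall>\<xi>\<in>C0U. \<forall>\<eta>\<in>C0U. (T1 \<xi>)\<^sup>\<star>\<^bsub>A\<^esub> \<otimes>\<^bsub>A\<^esub> T1 \<eta> = T0 (\<lambda>x. cnj (\<xi> x) * \<eta> x)) \<and>
    (\<forall>f\<in>C0 X. \<forall>\<xi>\<in>C0U. T0 f \<otimes>\<^bsub>A\<^esub> T1 \<xi> = T1 (\<lambda>x. pull f x * \<xi> x))"
  by (simp add: toeplitz_pair_def Cd_eq inner_eq pi_r_eq mult_op_def)

lemma push_add: "\<theta> (\<lambda>x. f x + g x) = (\<lambda>x. \<theta> f x + \<theta> g x)"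
  and push_scale: "\<theta> (\<lambda>x. c * f x) = (\<lambda>x. c * \<theta> f x)"
  and push_mult: "\<theta> (\<lambda>x. f x * g x) = (\<lambda>x. \<theta> f x * \<theta> g x)"
  and push_cnj: "\<theta> (\<lambda>x. cnj (f x)) = (\<lambda>x. cnj (\<theta> f x))"
  by (auto simp: push_def)

lemma pull_add: "pull (\<lambda>x. f x + g x) = (\<lambda>x. pull f x + pull g x)"
  and pull_scale: "pull (\<lambda>x. c * f x) = (\<lambda>x. c * pull f x)"
  and pull_mult: "pull (\<lambda>x. f x * g x) = (\<lambda>x. pull f x * pull g x)"
  and pull_cnj: "pull (\<lambda>x. cnj (f x)) = (\<lambda>x. cnj (pull f x))"
  by (auto simp: pull_def)

text \<open>Here \<open>f\<close> need not be supported in \<open>V\<close>, since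
  \<open>\<theta> \<xi>\<close> vanishes off \<open>V\<close>. This converts the left action through
  the range map into multiplication by \<open>f\<close>.\<close>

lemma push_pull_mult:
  assumes "\<xi> \<in> C0U" shows "\<theta> (\<lambda>x. pull f x * \<xi> x) = (\<lambda>x. f x * \<theta> \<xi> x)"
proof
  fix x show "\<theta> (\<lambda>x. pull f x * \<xi> x) x = f x * \<theta> \<xi> x"
  proof (cases "x \<in> V")
    case True
    then obtain u where "u \<in> U" "x = \<sigma> u"
      using image_U by blast
    then show ?thesis
      by (simp add: pull_def)
  qed (simp add: push_def)
qed

section \<open>From covariant pairs to Cuntz-Krieger pairs and back\<close>

text \<open>This supplies the homomorphism \<open>\<Phi>\<close> of the Cuntz-Krieger condition.
  Taking symbols turns operations on compact operators into pointwise ones, and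
  \<open>\<theta>\<close> carries symbols into \<open>C0 X\<close>, where \<open>R0\<close> is
  defined.\<close>

lemma star_hom_symbol:
  assumes R0: "star_hom (C0_alg X) B R0"
  shows "star_hom (compact_alg E) B (\<lambda>T. R0 (\<theta> (symbol T)))"
proof -
  note R = star_hom_C0D[OF R0]
  have \<theta>X: "\<theta> k \<in> C0 X" if "k \<in> C0U" for k
    using push_C0[OF that] C0V_subset by blast
  have add: "(\<lambda>\<zeta>\<in>C0U. \<lambda>e. mult_op k \<zeta> e + mult_op l \<zeta> e) = mult_op (\<lambda>x. k x + l x)" for k l
    by (auto simp: mult_op_def fun_eq_iff distrib_right)
  have scale: "(\<lambda>\<zeta>\<in>C0U. \<lambda>e. c * mult_op k \<zeta> e) = mult_op (\<lambda>x. c * k x)" for c k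
    by (auto simp: mult_op_def fun_eq_iff)
  \<comment> \<open>The inner value \<open>mult_op l \<zeta>\<close> must stay in
    \<open>C0U\<close>, since \<open>mult_op k\<close> is \<open>undefined\<close>
    elsewhere.\<close>
  have mult: "compose C0U (mult_op k) (mult_op l) = mult_op (\<lambda>x. k x * l x)" if "l \<in> C0U" for k l
    using mult_op_closed[OF that] by (auto simp: mult_op_def compose_def fun_eq_iff)
  have star: "(THE S. is_adjoint E (mult_op k) S) = mult_op (\<lambda>x. cnj (k x))" if "k \<in> C0U" for k
    using is_adjoint_mult_op_iff[OF that] by simp
  have repr: "\<exists>k. k \<in> C0U \<and> T = mult_op k" if "T \<in> carr (compact_alg E)" for T
  proof -
    have "T \<in> compact_ops E"
      using that by (simp add: compact_alg_def)
    then show ?thesis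
      by (rule compact_ops_eq) blast
  qed
  show ?thesis
    unfolding star_hom_def
  proof (intro conjI ballI allI)
    fix S T assume "S \<in> carr (compact_alg E)" "T \<in> carr (compact_alg E)"
    then obtain k l where k: "k \<in> C0U" "S = mult_op k" and l: "l \<in> C0U" "T = mult_op l"
      using repr[of S] repr[of T] by blast
    show "R0 (\<theta> (symbol (S \<oplus>\<^bsub>compact_alg E\<^esub> T))) = R0 (\<theta> (symbol S)) \<oplus>\<^bsub>B\<^esub> R0 (\<theta> (symbol T))"
      using k l by (simp add: compact_alg_def Cd_eq add symbol_mult_op C0_add push_add R \<theta>X)
    show "R0 (\<theta> (symbol (S \<otimes>\<^bsub>compact_alg E\<^esub> T))) = R0 (\<theta> (symbol S)) \<otimes>\<^bsub>B\<^esub> R0 (\<theta> (symbol T))"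
      using k l by (simp add: compact_alg_def Cd_eq mult symbol_mult_op C0_mult_C0 push_mult R \<theta>X)
  next
    fix T c assume "T \<in> carr (compact_alg E)"
    then obtain k where k: "k \<in> C0U" "T = mult_op k"
      using repr[of T] by blast
    show "R0 (\<theta> (symbol T)) \<in> carr B"
      using k by (simp add: symbol_mult_op R \<theta>X)
    show "R0 (\<theta> (symbol (c \<odot>\<^bsub>compact_alg E\<^esub> T))) = c \<odot>\<^bsub>B\<^esub> R0 (\<theta> (symbol T))"
      using k by (simp add: compact_alg_def Cd_eq scale symbol_mult_op C0_scale push_scale R \<theta>X)
    show "R0 (\<theta> (symbol (T\<^sup>\<star>\<^bsub>compact_alg E\<^esub>))) = (R0 (\<theta> (symbol T)))\<^sup>\<star>\<^bsub>B\<^esub>"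
      using k by (simp add: compact_alg_def star symbol_mult_op C0_cnj push_cnj R \<theta>X)
  qed
qed

text \<open>The relation \<open>inner\<close> yields the inner product formula because
  \<open>pull\<close> undoes \<open>\<theta>\<close>, \<open>left\<close> yields the left action
  through \<open>push_pull_mult\<close>, and \<open>outer\<close> gives the value of
  \<open>\<Phi>\<close> on rank one operators.\<close>

lemma covariant_imp_cuntz_krieger:
  assumes cov: "covariant_pair X U V \<theta> B R0 R1"
  shows "cuntz_krieger_pair E B R0 (R1 \<circ> \<theta>)"
proof -
  have R0: "star_hom (C0_alg X) B R0" and R1: "linear_into C0V B R1"
    and left: "\<And>f g. f \<in> C0 X \<Longrightarrow> g \<in> C0V \<Longrightarrow> R0 f \<otimes>\<^bsub>B\<^esub> R1 g = R1 (\<lambda>x. f x * g x)"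
    and outer: "\<And>g h. g \<in> C0V \<Longrightarrow> h \<in> C0V \<Longrightarrow> R1 g \<otimes>\<^bsub>B\<^esub> (R1 h)\<^sup>\<star>\<^bsub>B\<^esub> = R0 (\<lambda>x. g x * cnj (h x))"
    and inner: "\<And>g h. g \<in> C0V \<Longrightarrow> h \<in> C0V \<Longrightarrow>
      (R1 g)\<^sup>\<star>\<^bsub>B\<^esub> \<otimes>\<^bsub>B\<^esub> R1 h = R0 (pull (\<lambda>x. cnj (g x) * h x))"
    using cov unfolding covariant_pair_iff by blast+
  have "linear_into C0U B (R1 \<circ> \<theta>)"
    using R1 by (simp add: linear_into_def push_add push_scale push_C0)
  then have "toeplitz_pair E B R0 (R1 \<circ> \<theta>)"
    unfolding toeplitz_pair_iff
    by (simp add: R0 left inner push_C0 pull_mult pull_cnj pull_push push_pull_mult)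
  moreover have "R0 (\<theta> (symbol (rank_one E \<xi> \<eta>))) = (R1 \<circ> \<theta>) \<xi> \<otimes>\<^bsub>B\<^esub> ((R1 \<circ> \<theta>) \<eta>)\<^sup>\<star>\<^bsub>B\<^esub>"
    if "\<xi> \<in> C0U" "\<eta> \<in> C0U" for \<xi> \<eta>
    using that by (simp add: rank_one_eq symbol_mult_op C0_mult_C0 C0_cnj push_mult push_cnj outer push_C0)
  moreover have "R0 f = R0 (\<theta> (symbol (pi_r E f)))" if "f \<in> C0V" for f
    using that by (simp add: pi_r_eq symbol_mult_op pull_C0 push_pull)
  ultimately show ?thesis
    unfolding cuntz_krieger_pair_def Cd_eq E0_rg_eq graph_simps
    using star_hom_symbol[OF R0] by (intro conjI exI[of _ "\<lambda>T. R0 (\<theta> (symbol T))"]) auto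
qed

text \<open>The difference \<open>z\<close> of the two sides satisfies \<open>z\<^sup>\<star> z = 0\<close>, since all four products of their
  adjoints with them are \<open>T0\<close> of the same function.\<close>

lemma toeplitz_right_mult:
  assumes A: "cstar_algebra A" and T: "toeplitz_pair E A T0 T1" and \<xi>: "\<xi> \<in> C0U" and f: "f \<in> C0 X"
  shows "T1 \<xi> \<otimes>\<^bsub>A\<^esub> T0 f = T1 (\<lambda>x. \<xi> x * f x)"
proof -
  interpret cstar_algebra A
    by (rule A)
  have T0: "star_hom (C0_alg X) A T0" and T1: "\<And>\<eta>. \<eta> \<in> C0U \<Longrightarrow> T1 \<eta> \<in> carr A"
    and inner: "\<And>\<xi> \<eta>. \<xi> \<in> C0U \<Longrightarrow> \<eta> \<in> C0U \<Longrightarrow> (T1 \<xi>)\<^sup>\<star>\<^bsub>A\<^esub> \<otimes>\<^bsub>A\<^esub> T1 \<eta> = T0 (\<lambda>x. cnj (\<xi> x) * \<eta> x)"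
    using T unfolding toeplitz_pair_iff linear_into_def by blast+
  note T0D = star_hom_C0D[OF T0]
  have \<xi>f: "(\<lambda>x. \<xi> x * f x) \<in> C0U"
    using C0_mult_ideal[OF open_U f \<xi>] by (simp add: mult.commute)
  have X: "\<xi> \<in> C0 X" "(\<lambda>x. \<xi> x * f x) \<in> C0 X"
    using \<xi> \<xi>f C0U_subset by auto
  note [simp] = T1 \<xi> \<xi>f f X T0D(1) mult_closed star_closed C0_cnj C0_mult_C0
  let ?x = "T1 \<xi> \<otimes>\<^bsub>A\<^esub> T0 f" and ?y = "T1 (\<lambda>x. \<xi> x * f x)"
  let ?w = "\<lambda>x. cnj (\<xi> x * f x) * (\<xi> x * f x)"
  \<comment> \<open>The adjoint of \<open>?x\<close> begins with \<open>T0\<close> of the conjugate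
    of \<open>f\<close>; what remains is an inner product, so every product reduces to values of
    \<open>T0\<close>.\<close>
  have x_star: "?x\<^sup>\<star>\<^bsub>A\<^esub> \<otimes>\<^bsub>A\<^esub> y = T0 (\<lambda>x. cnj (f x)) \<otimes>\<^bsub>A\<^esub> ((T1 \<xi>)\<^sup>\<star>\<^bsub>A\<^esub> \<otimes>\<^bsub>A\<^esub> y)"
    if "y \<in> carr A" for y
    using that by (simp add: star_mult mult_assoc T0D(5))
  have star_x: "(T1 \<eta>)\<^sup>\<star>\<^bsub>A\<^esub> \<otimes>\<^bsub>A\<^esub> ?x = T0 (\<lambda>x. cnj (\<eta> x) * \<xi> x * f x)" if "\<eta> \<in> C0U" for \<eta>
  proof -
    have "\<eta> \<in> C0 X"
      using that C0U_subset by blast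
    then show ?thesis
      using that by (simp add: T0D(4) inner flip: mult_assoc)
  qed
  have w: "T0 (\<lambda>x. cnj (f x)) \<otimes>\<^bsub>A\<^esub> T0 (\<lambda>x. cnj (\<xi> x) * (\<xi> x * f x)) = T0 ?w"
    by (simp add: mult.assoc mult.left_commute flip: T0D(4))
  show ?thesis
  proof (rule eq_if_star_mult_eq)
    show "?x\<^sup>\<star>\<^bsub>A\<^esub> \<otimes>\<^bsub>A\<^esub> ?x = T0 ?w"
      using w by (simp add: x_star star_x mult.assoc)
    show "?x\<^sup>\<star>\<^bsub>A\<^esub> \<otimes>\<^bsub>A\<^esub> ?y = T0 ?w"
      using w by (simp add: x_star inner)
    show "?y\<^sup>\<star>\<^bsub>A\<^esub> \<otimes>\<^bsub>A\<^esub> ?x = T0 ?w"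
      by (simp add: star_x mult.assoc)
    show "?y\<^sup>\<star>\<^bsub>A\<^esub> \<otimes>\<^bsub>A\<^esub> ?y = T0 ?w"
      by (simp add: inner)
  qed simp_all
qed

lemma cuntz_krieger_imp_covariant:
  assumes A: "cstar_algebra A" and CK: "cuntz_krieger_pair E A T0 T1"
  shows "covariant_pair X U V \<theta> A T0 (T1 \<circ> pull)"
proof -
  have T: "toeplitz_pair E A T0 T1"
    using CK by (simp add: cuntz_krieger_pair_def)
  then have T0: "star_hom (C0_alg X) A T0" and T1: "linear_into C0U A T1"
    and inner: "\<And>\<xi> \<eta>. \<xi> \<in> C0U \<Longrightarrow> \<eta> \<in> C0U \<Longrightarrow> (T1 \<xi>)\<^sup>\<star>\<^bsub>A\<^esub> \<otimes>\<^bsub>A\<^esub> T1 \<eta> = T0 (\<lambda>x. cnj (\<xi> x) * \<eta> x)"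
    and left: "\<And>f \<xi>. f \<in> C0 X \<Longrightarrow> \<xi> \<in> C0U \<Longrightarrow> T0 f \<otimes>\<^bsub>A\<^esub> T1 \<xi> = T1 (\<lambda>x. pull f x * \<xi> x)"
    unfolding toeplitz_pair_iff by blast+
  obtain \<Phi> where \<Phi>: "\<And>\<xi> \<eta>. \<xi> \<in> C0U \<Longrightarrow> \<eta> \<in> C0U \<Longrightarrow> \<Phi> (rank_one E \<xi> \<eta>) = T1 \<xi> \<otimes>\<^bsub>A\<^esub> (T1 \<eta>)\<^sup>\<star>\<^bsub>A\<^esub>"
    "\<And>f. f \<in> C0V \<Longrightarrow> T0 f = \<Phi> (pi_r E f)"
    using CK unfolding cuntz_krieger_pair_def Cd_eq E0_rg_eq graph_simps by blast
  have "linear_into C0V A (T1 \<circ> pull)"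
    using T1 by (simp add: linear_into_def pull_add pull_scale pull_C0)
  moreover have "T0 f \<otimes>\<^bsub>A\<^esub> (T1 \<circ> pull) g = (T1 \<circ> pull) (\<lambda>x. f x * g x)" if "f \<in> C0 X" "g \<in> C0V" for f g
    using that by (simp add: left pull_C0 pull_mult)
  moreover have "(T1 \<circ> pull) g \<otimes>\<^bsub>A\<^esub> T0 f = (T1 \<circ> pull) (\<theta> (\<lambda>x. pull g x * f x))"
    if f: "f \<in> C0 X" and g: "g \<in> C0V" for f g
  proof -
    have "(\<lambda>x. pull g x * f x) \<in> C0U"
      using C0_mult_ideal[OF open_U f pull_C0[OF g]] by (simp add: mult.commute)
    then show ?thesis
      using toeplitz_right_mult[OF A T pull_C0[OF g] f] by (simp add: pull_push)
  qed
  \<comment> \<open>The rank one operator of \<open>pull g\<close> and \<open>pull h\<close>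
    coincides with \<open>pi_r E\<close> of \<open>g\<close> times the conjugate of
    \<open>h\<close>, so the two clauses on \<open>\<Phi>\<close> evaluate it at the same
    operator.\<close>
  moreover have "(T1 \<circ> pull) g \<otimes>\<^bsub>A\<^esub> ((T1 \<circ> pull) h)\<^sup>\<star>\<^bsub>A\<^esub> = T0 (\<lambda>x. g x * cnj (h x))"
    if "g \<in> C0V" "h \<in> C0V" for g h
    using that \<Phi>(1)[of "pull g" "pull h"] \<Phi>(2)[of "\<lambda>x. g x * cnj (h x)"]
    by (simp add: pull_C0 rank_one_eq pi_r_eq pull_mult pull_cnj C0_mult_C0 C0_cnj)
  moreover have "((T1 \<circ> pull) g)\<^sup>\<star>\<^bsub>A\<^esub> \<otimes>\<^bsub>A\<^esub> (T1 \<circ> pull) h = T0 (pull (\<lambda>x. cnj (g x) * h x))"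
    if "g \<in> C0V" "h \<in> C0V" for g h
    using that by (simp add: inner pull_C0 pull_mult pull_cnj)
  ultimately show ?thesis
    using T0 unfolding covariant_pair_iff by blast
qed

end

section \<open>The isomorphism from the two universal properties\<close>

theorem proposition10p5:
  fixes X :: "'x topology" and U V :: "'x set" and \<sigma> :: "'x \<Rightarrow> 'x"
    and A B :: "'a cstar"
    and t0 t1 \<rho>0 \<rho>1 :: "('x \<Rightarrow> complex) \<Rightarrow> 'a"
  assumes "locally_compact_space X" and "Hausdorff_space X"
    and "partial_homeomorphism X U V \<sigma>"
    and "graph_algebra (partial_homeo_graph X U \<sigma>) A t0 t1"
    and "crossed_product X U V (push U V \<sigma>) B \<rho>0 \<rho>1"
  shows "\<exists>\<phi>. star_iso A B \<phi> \<and>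
    (\<forall>f\<in>C0 X. \<phi> (t0 f) = \<rho>0 f) \<and>
    (\<forall>\<xi>\<in>Cd (partial_homeo_graph X U \<sigma>). \<phi> (t1 \<xi>) = \<rho>1 (push U V \<sigma> \<xi>))"
proof -
  interpret partial_homeo X U V \<sigma>
    using assms(1-3) by unfold_locales
  have A: "cstar_algebra A" and CK: "cuntz_krieger_pair E A t0 t1"
    and univ_A: "\<And>(D :: 'a cstar) T0 T1. \<lbrakk>cstar_algebra D; cuntz_krieger_pair E D T0 T1\<rbrakk> \<Longrightarrow>
       \<exists>!\<phi>. \<phi> \<in> extensional (carr A) \<and> star_hom A D \<phi> \<and>
          (\<forall>f\<in>C0 X. \<phi> (t0 f) = T0 f) \<and> (\<forall>\<xi>\<in>C0U. \<phi> (t1 \<xi>) = T1 \<xi>)"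
    using assms(4) unfolding graph_algebra_def Cd_eq graph_simps by blast+
  have B: "cstar_algebra B" and cov: "covariant_pair X U V \<theta> B \<rho>0 \<rho>1"
    and univ_B: "\<And>(D :: 'a cstar) R0 R1. \<lbrakk>cstar_algebra D; covariant_pair X U V \<theta> D R0 R1\<rbrakk> \<Longrightarrow>
       \<exists>!\<phi>. \<phi> \<in> extensional (carr B) \<and> star_hom B D \<phi> \<and>
          (\<forall>f\<in>C0 X. \<phi> (\<rho>0 f) = R0 f) \<and> (\<forall>g\<in>C0V. \<phi> (\<rho>1 g) = R1 g)"
    using assms(5) unfolding crossed_product_def by blast+
  \<comment> \<open>Both algebras have carriers in the type \<open>'a\<close>, so each is an
    admissible target for the universal property of the other.\<close>
  obtain \<phi> where \<phi>: "star_hom A B \<phi>" and \<phi>0: "\<And>f. f \<in> C0 X \<Longrightarrow> \<phi> (t0 f) = \<rho>0 f"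
    and \<phi>1: "\<And>\<xi>. \<xi> \<in> C0U \<Longrightarrow> \<phi> (t1 \<xi>) = \<rho>1 (\<theta> \<xi>)"
    using univ_A[OF B covariant_imp_cuntz_krieger[OF cov]] by auto
  obtain \<psi> where \<psi>: "star_hom B A \<psi>" and \<psi>0: "\<And>f. f \<in> C0 X \<Longrightarrow> \<psi> (\<rho>0 f) = t0 f"
    and \<psi>1: "\<And>g. g \<in> C0V \<Longrightarrow> \<psi> (\<rho>1 g) = t1 (pull g)"
    using univ_B[OF A cuntz_krieger_imp_covariant[OF A CK]] by auto
  have t: "\<And>f. f \<in> C0 X \<Longrightarrow> t0 f \<in> carr A" "\<And>\<xi>. \<xi> \<in> C0U \<Longrightarrow> t1 \<xi> \<in> carr A"
    using CK star_hom_C0D(1) unfolding cuntz_krieger_pair_def toeplitz_pair_iff linear_into_def by blast+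
  have \<rho>: "\<And>f. f \<in> C0 X \<Longrightarrow> \<rho>0 f \<in> carr B" "\<And>g. g \<in> C0V \<Longrightarrow> \<rho>1 g \<in> carr B"
    using cov star_hom_C0D(1) unfolding covariant_pair_iff linear_into_def by blast+
  \<comment> \<open>Only uniqueness is extracted: \<open>\<alpha>\<close> is the extensional
    endomorphism fixing the generators, with which both the composite and the identity are then
    identified.\<close>
  obtain \<alpha> where \<alpha>: "\<And>F. \<lbrakk>F \<in> extensional (carr A); star_hom A A F;
      \<And>f. f \<in> C0 X \<Longrightarrow> F (t0 f) = t0 f; \<And>\<xi>. \<xi> \<in> C0U \<Longrightarrow> F (t1 \<xi>) = t1 \<xi>\<rbrakk> \<Longrightarrow> F = \<alpha>"
    using univ_A[OF A CK] by (elim ex1E) blast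
  have "restrict (\<psi> \<circ> \<phi>) (carr A) = \<alpha>"
    by (rule \<alpha>) (simp_all add: star_hom_compose[OF A \<phi> \<psi>] t \<phi>0 \<phi>1 \<psi>0 \<psi>1 push_C0 pull_push)
  moreover have "restrict id (carr A) = \<alpha>"
    by (rule \<alpha>) (simp_all add: star_hom_id[OF A] t)
  ultimately have \<psi>\<phi>: "\<psi> (\<phi> x) = x" if "x \<in> carr A" for x
    using that by (metis comp_apply id_apply restrict_apply')
  obtain \<beta> where \<beta>: "\<And>F. \<lbrakk>F \<in> extensional (carr B); star_hom B B F;
      \<And>f. f \<in> C0 X \<Longrightarrow> F (\<rho>0 f) = \<rho>0 f; \<And>g. g \<in> C0V \<Longrightarrow> F (\<rho>1 g) = \<rho>1 g\<rbrakk> \<Longrightarrow> F = \<beta>"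
    using univ_B[OF B cov] by (elim ex1E) blast
  have "restrict (\<phi> \<circ> \<psi>) (carr B) = \<beta>"
    by (rule \<beta>) (simp_all add: star_hom_compose[OF B \<psi> \<phi>] \<rho> \<phi>0 \<phi>1 \<psi>0 \<psi>1 pull_C0 push_pull)
  moreover have "restrict id (carr B) = \<beta>"
    by (rule \<beta>) (simp_all add: star_hom_id[OF B] \<rho>)
  ultimately have \<phi>\<psi>: "\<phi> (\<psi> y) = y" if "y \<in> carr B" for y
    using that by (metis comp_apply id_apply restrict_apply')
  have "star_iso A B \<phi>"
    using \<phi> \<psi> \<psi>\<phi> \<phi>\<psi> by (rule star_isoI)
  then show ?thesis
    using \<phi>0 \<phi>1 by (auto simp: Cd_eq)
qed

end
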